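(* Let $n_1,n_2,p\in\mathbb N$ and let $S_i\in\mathbb S_p(\mathbb R)$ for $i\in\{-2n_1,-2n_1+1,\dots,2n_2\}$. Then the following statements are equivalent: (1) There exists a positive $\mathbb S_p(\mathbb R)$-valued measure $\mu$ such that $S_i=\int_{\mathbb R}x^i\,d\mu$ for all $i\in\{-2n_1,\dots,2n_2\}$. (2) There exists a finitely atomic positive $\mathbb S_p(\mathbb R)$-valued measure $\mu$ such that $S_i=\int_{\mathbb R}x^i\,d\mu$ for all $i\in\{-2n_1,\dots,2n_2\}$. (3) There exists a minimal representing measure $\mu$ such that $S_i=\int_{\mathbb R}x^i\,d\mu$ for all $i\in\{-2n_1,\dots,2n_2\}$. (4) The block matrix $(S_{i+j})_{i,j=-n_1}^{n_2}$ is positive semidefinite and $\ker(S_{i+j})_{i,j=-n_1}^{n_2-1}=\ker(S_{i+j})_{i,j=-n_1+1}^{n_2}$. (5) The block matrix $(S_{i+j})_{i,j=-n_1}^{n_2}$ is positive semidefinite and for every sequence $\{v_k\}_{k=0}^{n_1+n_2-1}\subset\mathbb R^p$, $$\sum_{i,j=-n_1}^{n_2-1}v_{j+n_1}^TS_{i+j}v_{i+n_1}=0\quad\text{if and only if}\quad\sum_{i,j=-n_1}^{n_2-1}v_{j+n_1}^TS_{i+j+2}v_{i+n_1}=0.$$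
   Context: $\mathbb N=\{1,2,\dots\}$; $\mathbb S_p(\mathbb R)$ is the space of real symmetric $p\times p$ matrices. A positive $\mathbb S_p(\mathbb R)$-valued measure is a map $\mu=(\mu_{ij})_{i,j=1}^p:\mathrm{Bor}(\mathbb R)\to\mathbb S_p(\mathbb R)$ such that every $\mu_{ij}$ is a real (signed) measure and $\mu(\Delta)$ is positive semidefinite for each Borel set $\Delta$. A function $f$ is $\mu$-integrable if $f\in L^1(\tau)$ with $\tau=\sum_i\mu_{ii}$, and then $\int f\,d\mu:=(\int f\,d\mu_{ij})_{i,j=1}^p$. The existence of the integrals $\int x^i\,d\mu$ with $i<0$ is understood to include $\mu(\{0\})=0$. $\mu$ is finitely atomic if $\mu=\sum_{j=1}^\ell\delta_{x_j}A_j$ for some $\ell\in\mathbb N$, $x_j\in\mathbb R$ and positive semidefinite $A_j\in\mathbb S_p(\mathbb R)$. With the $x_j$ pairwise distinct, the $A_j$ are its masses. A finitely atomic measure $\mu$ with $S_i=\int x^i\,d\mu$ for all $i\in\{-2n_1,\dots,2n_2\}$ is a minimal representing measure if the sum $\sum_j\operatorname{rank}A_j$ of the ranks of its masses is smallest among all finitely atomic measures with this property. *)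

theory Defs
  imports "HOL-Analysis.Analysis"
begin

definition psd_matrix :: "real^'n^'n \<Rightarrow> bool" where
  "psd_matrix A \<longleftrightarrow> transpose A = A \<and> (\<forall>x. 0 \<le> x \<bullet> (A *v x))"

text \<open>Only the values of these set functions on Borel sets matter.
  The positive and the negative variation are the two parts of the Jordan decomposition.\<close>

definition signed_borel_measure :: "(real set \<Rightarrow> real) \<Rightarrow> bool" where
  "signed_borel_measure \<nu> \<longleftrightarrow> \<nu> {} = 0 \<and>
     (\<forall>A :: nat \<Rightarrow> real set. range A \<subseteq> sets borel \<longrightarrow> disjoint_family A \<longrightarrow>
        (\<lambda>n. \<nu> (A n)) sums \<nu> (\<Union>n. A n))"

definition pos_variation :: "(real set \<Rightarrow> real) \<Rightarrow> real measure" where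
  "pos_variation \<nu> = measure_of UNIV (sets borel)
     (\<lambda>A. SUP B\<in>{B \<in> sets borel. B \<subseteq> A}. ennreal (\<nu> B))"

definition neg_variation :: "(real set \<Rightarrow> real) \<Rightarrow> real measure" where
  "neg_variation \<nu> = pos_variation (\<lambda>A. - \<nu> A)"

definition signed_integral :: "(real set \<Rightarrow> real) \<Rightarrow> (real \<Rightarrow> real) \<Rightarrow> real" where
  "signed_integral \<nu> f = integral\<^sup>L (pos_variation \<nu>) f - integral\<^sup>L (neg_variation \<nu>) f"

definition positive_matrix_measure :: "(real set \<Rightarrow> real^'p^'p) \<Rightarrow> bool" where
  "positive_matrix_measure \<mu> \<longleftrightarrow>
     (\<forall>i j. signed_borel_measure (\<lambda>\<Delta>. \<mu> \<Delta> $ i $ j)) \<and>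
     (\<forall>\<Delta>\<in>sets borel. psd_matrix (\<mu> \<Delta>))"

definition trace_measure :: "(real set \<Rightarrow> real^'p^'p) \<Rightarrow> real measure" where
  "trace_measure \<mu> = measure_of UNIV (sets borel) (\<lambda>\<Delta>. ennreal (trace (\<mu> \<Delta>)))"

definition matrix_integrable :: "(real set \<Rightarrow> real^'p^'p) \<Rightarrow> (real \<Rightarrow> real) \<Rightarrow> bool" where
  "matrix_integrable \<mu> f \<longleftrightarrow> integrable (trace_measure \<mu>) f"

definition matrix_integral :: "(real set \<Rightarrow> real^'p^'p) \<Rightarrow> (real \<Rightarrow> real) \<Rightarrow> real^'p^'p" where
  "matrix_integral \<mu> f = (\<chi> i j. signed_integral (\<lambda>\<Delta>. \<mu> \<Delta> $ i $ j) f)"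

text \<open>Since \<open>0 powi i = 0\<close> for \<open>i < 0\<close>, the absence of an atom at \<open>0\<close> must be required explicitly
  for the negative moments to exist.\<close>

definition has_moments ::
    "nat \<Rightarrow> nat \<Rightarrow> (int \<Rightarrow> real^'p^'p) \<Rightarrow> (real set \<Rightarrow> real^'p^'p) \<Rightarrow> bool" where
  "has_moments n1 n2 S \<mu> \<longleftrightarrow>
     (\<forall>i\<in>{- 2 * int n1 .. 2 * int n2}.
        (i < 0 \<longrightarrow> \<mu> {0} = 0) \<and>
        matrix_integrable \<mu> (\<lambda>x. x powi i) \<and>
        S i = matrix_integral \<mu> (\<lambda>x. x powi i))"

definition finitely_atomic :: "(real set \<Rightarrow> real^'p^'p) \<Rightarrow> bool" where
  "finitely_atomic \<mu> \<longleftrightarrow>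
     (\<exists>l\<ge>1. \<exists>(x :: nat \<Rightarrow> real) (A :: nat \<Rightarrow> real^'p^'p).
        (\<forall>j<l. psd_matrix (A j)) \<and>
        (\<forall>\<Delta>\<in>sets borel. \<mu> \<Delta> = (\<Sum>j<l. indicator \<Delta> (x j) *\<^sub>R A j)))"

text \<open>For a finitely atomic measure with pairwise distinct \<open>x\<^sub>j\<close> the mass at \<open>x\<^sub>j\<close> is \<open>\<mu> {x\<^sub>j}\<close>;
  vanishing masses have rank \<open>0\<close>.  The index set is finite when \<open>\<mu>\<close> is finitely atomic.\<close>

definition mass_rank_sum :: "(real set \<Rightarrow> real^'p^'p) \<Rightarrow> nat" where
  "mass_rank_sum \<mu> = (\<Sum>x\<in>{x. \<mu> {x} \<noteq> 0}. rank (\<mu> {x}))"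

definition minimal_representing_measure ::
    "nat \<Rightarrow> nat \<Rightarrow> (int \<Rightarrow> real^'p^'p) \<Rightarrow> (real set \<Rightarrow> real^'p^'p) \<Rightarrow> bool" where
  "minimal_representing_measure n1 n2 S \<mu> \<longleftrightarrow>
     finitely_atomic \<mu> \<and> has_moments n1 n2 S \<mu> \<and>
     (\<forall>\<nu>. finitely_atomic \<nu> \<longrightarrow> has_moments n1 n2 S \<nu> \<longrightarrow> mass_rank_sum \<mu> \<le> mass_rank_sum \<nu>)"

text \<open>An \<open>N \<times> N\<close> block matrix is given by its blocks \<open>M r c\<close> with \<open>r, c < N\<close>, and a block vector
  with \<open>N\<close> blocks by a function on \<open>{..<N}\<close>.  In the kernel, block vectors are extended by \<open>0\<close>, so
  that equality of kernels is equality of subsets of a copy of \<open>\<real>\<^bsup>Np\<^esup>\<close>.\<close>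

definition block_psd :: "nat \<Rightarrow> (nat \<Rightarrow> nat \<Rightarrow> real^'p^'p) \<Rightarrow> bool" where
  "block_psd N M \<longleftrightarrow>
     (\<forall>r<N. \<forall>c<N. M c r = transpose (M r c)) \<and>
     (\<forall>v :: nat \<Rightarrow> real^'p. 0 \<le> (\<Sum>r<N. \<Sum>c<N. v r \<bullet> (M r c *v v c)))"

definition block_ker :: "nat \<Rightarrow> (nat \<Rightarrow> nat \<Rightarrow> real^'p^'p) \<Rightarrow> (nat \<Rightarrow> real^'p) set" where
  "block_ker N M = {v. (\<forall>k\<ge>N. v k = 0) \<and> (\<forall>r<N. (\<Sum>c<N. M r c *v v c) = 0)}"

text \<open>The matrix \<open>(S\<^sub>i\<^sub>+\<^sub>j)\<close> with \<open>i\<close> and \<open>j\<close> running through \<open>a, a + 1, \<dots>\<close>, as a block matrix with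
  indices starting at \<open>0\<close>; its size is the \<open>N\<close> above.\<close>

definition moment_block :: "(int \<Rightarrow> real^'p^'p) \<Rightarrow> int \<Rightarrow> nat \<Rightarrow> nat \<Rightarrow> real^'p^'p" where
  "moment_block S a r c = S ((a + int r) + (a + int c))"

end

theory Submission
  imports Defs "HOL-Library.Function_Algebras" "HOL-Computational_Algebra.Fundamental_Theorem_Algebra"
begin

text \<open>
  Put \<open>N = n1 + n2\<close> and \<open>s k = S (k - 2 n1)\<close>.  Multiplying a representing measure by \<open>x\<close> to the power
  \<open>- 2 n1\<close> turns the problem into a truncated Hamburger problem for \<open>s 0, \<dots>, s (2 N)\<close> with measures that
  have no atom at \<open>0\<close>.  With the semidefinite form given by the block Hankel matrix of \<open>s\<close>, the
  shift of block vectors is a symmetric operator defined on the vectors with vanishing last block; the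
  kernel condition says that it is well defined and injective modulo null vectors.  Such an operator has
  an injective symmetric extension \<open>T\<close> to all block vectors.  The powers of \<open>T\<close> define a positive
  functional on real polynomials that is annihilated by a nonzero polynomial and extends \<open>s\<close>; a
  minimal annihilator has simple, real, nonzero roots, and these are the atoms.

  Conversely, a representing measure has a positive semidefinite density with respect to its trace measure.
  Both quadratic forms are integrals of nonnegative functions which differ by the factor \<open>x\<^sup>2\<close>, and
  \<open>x\<^sup>2\<close> vanishes almost nowhere, so that the forms have the same zeros.
\<close>

subsection \<open>Positive functionals on real polynomials\<close>

text \<open>Stands in for the Cauchy-Schwarz inequality: along a null direction a nonnegative
  quadratic form is affine in the parameter, so its mixed term vanishes.\<close>

lemma affine_nonneg_slope_zero:
  fixes a c :: real
  assumes "\<And>t. 0 \<le> a + t * c"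
  shows "c = 0"
proof (rule ccontr)
  assume "c \<noteq> 0"
  then show False
    using assms[of "- (a + 1) / c"] by simp
qed

lemma symmetric_inner_matrix:
  fixes A :: "real^'n^'n"
  assumes "transpose A = A"
  shows "y \<bullet> (A *v x) = x \<bullet> (A *v y)"
  by (metis assms dot_lmul_matrix inner_commute transpose_matrix_vector)

text \<open>Polarization: expanding the form at \<open>x + y\<close> leaves twice the mixed
  term.\<close>

lemma symmetric_matrix_eq_0:
  fixes A :: "real^'n^'n"
  assumes "transpose A = A" and "\<And>u. u \<bullet> (A *v u) = 0"
  shows "A = 0"
proof -
  have "x \<bullet> (A *v y) = 0" for x y
    using assms(2)[of "x + y"] assms(2)[of x] assms(2)[of y] symmetric_inner_matrix[OF assms(1), of y x]
    by (simp add: matrix_vector_right_distrib inner_add_left inner_add_right)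
  then have "A *v y = 0" for y
    by (metis inner_eq_zero_iff)
  then show ?thesis
    by (simp add: matrix_eq)
qed

text \<open>Polynomials form an infinite-dimensional space, so finitely many functionals have a
  common nonzero zero. In the induction, two common zeros of the first \<open>n\<close> functionals
  are combined so that the last one vanishes too.\<close>

lemma common_kernel_poly:
  fixes \<phi> :: "nat \<Rightarrow> real poly \<Rightarrow> real"
  assumes "\<And>i f g. \<phi> i (f + g) = \<phi> i f + \<phi> i g"
    and "\<And>i c f. \<phi> i (smult c f) = c * \<phi> i f"
  shows "\<exists>q. q \<noteq> 0 \<and> (\<forall>i<n. \<phi> i q = 0)"
  using assms
proof (induction n arbitrary: \<phi>)
  case 0
  then show ?case by (intro exI[of _ 1]) auto
next
  case (Suc n)
  obtain q where q: "q \<noteq> 0" "\<forall>i<n. \<phi> i q = 0"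
    using Suc.IH[of \<phi>] Suc.prems by auto
  \<comment> \<open>Multiplying by a monomial of degree above that of \<open>q\<close> gives the
    second candidate a larger degree than \<open>q\<close>, so the combination below is not
    zero.\<close>
  define m where "m = monom (1::real) (Suc (degree q))"
  have "\<exists>r. r \<noteq> 0 \<and> (\<forall>i<n. \<phi> i (m * r) = 0)"
    using Suc.prems by (intro Suc.IH) (auto simp: algebra_simps)
  then obtain r where r: "r \<noteq> 0" "\<forall>i<n. \<phi> i (m * r) = 0"
    by blast
  show ?case
  proof (cases "\<phi> n q = 0")
    case True
    with q show ?thesis by (metis less_Suc_eq)
  next
    case False
    define f where "f = smult (\<phi> n q) (m * r) + smult (- \<phi> n (m * r)) q"
    have "degree q < degree (m * r)"
      using r by (simp add: m_def degree_mult_eq degree_monom_eq)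
    then have "degree f = degree (m * r)"
      unfolding f_def using False by (subst degree_add_eq_left) auto
    with \<open>degree q < degree (m * r)\<close> have "f \<noteq> 0" by auto
    moreover have "\<phi> i f = 0" if "i < Suc n" for i
      using that q(2) r(2) unfolding f_def Suc.prems by (cases "i = n") auto
    ultimately show ?thesis by blast
  qed
qed

lemma prod_linear_dvd:
  fixes q :: "real poly"
  assumes "finite \<Lambda>" "\<And>x. x \<in> \<Lambda> \<Longrightarrow> poly q x = 0"
  shows "(\<Prod>x\<in>\<Lambda>. [:-x, 1:]) dvd q"
  using assms
proof (induction \<Lambda> rule: finite_induct)
  case (insert a \<Lambda>)
  then obtain r where r: "q = (\<Prod>x\<in>\<Lambda>. [:-x, 1:]) * r" by auto
  have "poly (\<Prod>x\<in>\<Lambda>. [:-x, 1:]) a \<noteq> 0"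
    using insert.hyps by (auto simp: poly_prod)
  with insert.prems[of a] r have "poly r a = 0" by auto
  then have "[:-a, 1:] dvd r" by (simp add: poly_eq_0_iff_dvd)
  then show ?case
    unfolding r prod.insert[OF insert.hyps] by (subst mult.commute) (rule mult_dvd_mono[OF dvd_refl])
qed simp

section \<open>Non-real roots of real polynomials\<close>

lemma map_poly_of_real_add:
  "map_poly complex_of_real (p + q) = map_poly complex_of_real p + map_poly complex_of_real q"
  by (rule poly_eqI) (simp add: coeff_map_poly)

lemma map_poly_of_real_mult:
  "map_poly complex_of_real (p * q) = map_poly complex_of_real p * map_poly complex_of_real q"
  by (rule poly_eqI) (simp add: coeff_map_poly coeff_mult)

lemma poly_map_poly_of_real:
  "poly (map_poly complex_of_real p) (complex_of_real x) = complex_of_real (poly p x)"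
  by (induction p) (simp_all add: map_poly_pCons)

text \<open>The quadratic is the product of the linear factors of \<open>z\<close> and its
  conjugate. The remainder of \<open>q\<close> modulo it is real, of degree below 2 and vanishes at
  the non-real \<open>z\<close>, so it is zero.\<close>

lemma conjugate_root_quadratic_dvd:
  fixes q :: "real poly" and z :: complex
  assumes "poly (map_poly complex_of_real q) z = 0" and "Im z \<noteq> 0"
  shows "[:(Re z)\<^sup>2 + (Im z)\<^sup>2, - 2 * Re z, 1:] dvd q"
proof -
  define d where "d = [:(Re z)\<^sup>2 + (Im z)\<^sup>2, - 2 * Re z, 1:]"
  have dz: "poly (map_poly complex_of_real d) z = 0"
    by (simp add: d_def map_poly_pCons complex_eq_iff power2_eq_square algebra_simps)
  have "degree d = 2" by (simp add: d_def)
  then have d0: "d \<noteq> 0" by auto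
  have deg: "degree (q mod d) < 2"
    using degree_mod_less[OF d0, of q] \<open>degree d = 2\<close> by auto
  have "q = d * (q div d) + q mod d" by simp
  then have "map_poly complex_of_real q =
      map_poly complex_of_real d * map_poly complex_of_real (q div d) + map_poly complex_of_real (q mod d)"
    by (metis map_poly_of_real_add map_poly_of_real_mult)
  with assms dz have rz: "poly (map_poly complex_of_real (q mod d)) z = 0" by simp
  obtain a b where ab: "q mod d = [:a, b:]"
  proof
    show "q mod d = [:coeff (q mod d) 0, coeff (q mod d) 1:]"
      using deg by (intro poly_eqI) (auto simp: coeff_pCons coeff_eq_0 split: nat.split)
  qed
  have "complex_of_real a + z * complex_of_real b = 0"
    using rz unfolding ab by (simp add: map_poly_pCons)
  then have "a + Re z * b = 0" "Im z * b = 0"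
    by (simp_all add: complex_eq_iff)
  with assms(2) have "q mod d = 0"
    unfolding ab by simp
  then show ?thesis by (auto simp: d_def)
qed

text \<open>Let \<open>q\<close> be an annihilator of minimal degree.  It has neither multiple nor non-real roots, nor
  the root \<open>0\<close>, as positivity turns the cofactor into an annihilator of smaller degree.  So
  \<open>L\<close> factors through evaluation at the roots, and the weights are \<open>L\<close> of Lagrange polynomials.\<close>

lemma positive_functional_atomic:
  fixes L :: "real poly \<Rightarrow> real^'p^'p"
  assumes add: "\<And>f g. L (f + g) = L f + L g"
    and smult: "\<And>c f. L (smult c f) = c *\<^sub>R L f"
    and sym: "\<And>f. transpose (L f) = L f"
    and pos: "\<And>f u. 0 \<le> u \<bullet> (L (f * f) *v u)"
    and ann: "\<exists>q. q \<noteq> 0 \<and> (\<forall>f. L (q * f) = 0)"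
    and inj: "\<And>f u. u \<bullet> (L ((monom 1 1 * f) * (monom 1 1 * f)) *v u) = 0 \<Longrightarrow> u \<bullet> (L (f * f) *v u) = 0"
  obtains \<Lambda> A where "finite \<Lambda>" "0 \<notin> \<Lambda>" "\<And>x. psd_matrix (A x)"
    "\<And>f. L f = (\<Sum>x\<in>\<Lambda>. poly f x *\<^sub>R A x)"
proof -
  define I where "I = {q. \<forall>f. L (q * f) = 0}"
  \<comment> \<open>If \<open>r\<close> is null for all the forms
    \<open>u \<bullet> (L (f * g) *v u)\<close>, it is orthogonal to every \<open>f\<close>, hence
    an annihilator. This is how cofactors of \<open>q\<close> get into \<open>I\<close>
    below.\<close>
  have I: "r \<in> I" if "\<And>u. u \<bullet> (L (r * r) *v u) = 0" for r
  proof -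
    have "L (r * f) = 0" for f
    proof (rule symmetric_matrix_eq_0[OF sym])
      fix u
      have "0 \<le> u \<bullet> (L (f * f) *v u) + t * (2 * (u \<bullet> (L (r * f) *v u)))" for t
      proof -
        have "(f + smult t r) * (f + smult t r) = f * f + (smult (2 * t) (r * f) + smult (t * t) (r * r))"
          unfolding mult_2 by (simp only: ring_distribs smult_add_left mult_smult_left mult_smult_right smult_smult mult_ac add_ac)
        then show ?thesis
          using pos[of u "f + smult t r"] that[of u]
          by (simp add: add smult matrix_vector_mult_add_rdistrib inner_add_right
              scaleR_matrix_vector_assoc[symmetric])
      qed
      then show "u \<bullet> (L (r * f) *v u) = 0"
        using affine_nonneg_slope_zero by (metis mult_eq_0_iff zero_neq_numeral)
    qed
    then show ?thesis by (simp add: I_def)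
  qed
  define q where "q = arg_min degree (\<lambda>q. q \<in> I \<and> q \<noteq> 0)"
  have q: "q \<in> I" "q \<noteq> 0"
    using arg_min_natI[of "\<lambda>q. q \<in> I \<and> q \<noteq> 0" _ degree] ann by (auto simp: q_def I_def)
  have q_min: "degree q \<le> degree r" if "r \<in> I" "r \<noteq> 0" for r
    using arg_min_nat_le[of "\<lambda>q. q \<in> I \<and> q \<noteq> 0" r degree] that by (auto simp: q_def)
  have L0: "L (q * f) = 0" for f using q(1) by (simp add: I_def)
  have small: False if "q = d * r" "r \<in> I" "degree d > 0" for d r
  proof -
    have "r \<noteq> 0" "d \<noteq> 0" using that(1) q(2) by auto
    then have "degree q = degree d + degree r" using that(1) degree_mult_eq by blast
    then show False using q_min[OF that(2) \<open>r \<noteq> 0\<close>] that(3) by simp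
  qed
  have nonzero: "poly q 0 \<noteq> 0"
  proof
    assume "poly q 0 = 0"
    then obtain r where r: "q = [:0, 1:] * r"
      by (metis poly_eq_0_iff_dvd dvdE minus_zero)
    have x: "[:0, 1:] = monom (1::real) 1" by (simp add: monom_altdef)
    have "r \<in> I"
    proof (rule I, rule inj)
      fix u
      \<comment> \<open>One factor \<open>monom 1 1 * r\<close> is \<open>q\<close> itself, so
        \<open>L\<close> kills the square; \<open>inj\<close> then passes to
        \<open>r\<close>.\<close>
      have "(monom 1 1 * r) * (monom 1 1 * r) = q * (monom 1 1 * r)" by (simp only: r x)
      then show "u \<bullet> (L ((monom 1 1 * r) * (monom 1 1 * r)) *v u) = 0" by (simp only: L0 matrix_vector_mult_0 inner_zero_right)
    qed
    from small[OF r this] show False by simp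
  qed
  have simple: False if "q = [:-a, 1:] * ([:-a, 1:] * r)" for a r
  proof -
    \<comment> \<open>For a double root the square of the cofactor \<open>?c\<close> is a multiple
      of \<open>q\<close>, so \<open>?c\<close> is an annihilator of smaller degree.\<close>
    let ?c = "[:-a, 1:] * r"
    have "?c \<in> I"
    proof (rule I)
      fix u
      have "?c * ?c = q * r" using that by (simp only: mult_ac)
      then show "u \<bullet> (L (?c * ?c) *v u) = 0" by (simp only: L0 matrix_vector_mult_0 inner_zero_right)
    qed
    from small[OF that this] show False by simp
  qed
  have real: "Im z = 0" if z: "poly (map_poly complex_of_real q) z = 0" for z
  proof (rule ccontr)
    assume im: "Im z \<noteq> 0"
    define d where "d = [:(Re z)\<^sup>2 + (Im z)\<^sup>2, - 2 * Re z, 1:]"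
    obtain r where r: "q = d * r"
      using conjugate_root_quadratic_dvd[OF z im] by (auto simp: d_def)
    let ?c = "[:- Re z, 1:] * r"
    have "r \<in> I"
    proof (rule I)
      fix u
      \<comment> \<open>Completing the square writes \<open>0 = L (q * r)\<close> as a sum of two
        nonnegative terms, in which \<open>r * r\<close> has a positive coefficient.\<close>
      have "d = [:- Re z, 1:] * [:- Re z, 1:] + [:(Im z)\<^sup>2:]"
        by (simp add: d_def power2_eq_square)
      then have "q * r = ?c * ?c + smult ((Im z)\<^sup>2) (r * r)"
        unfolding r by (simp add: algebra_simps del: mult_pCons_left mult_pCons_right) simp
      then have "0 = u \<bullet> (L (?c * ?c) *v u) + (Im z)\<^sup>2 * (u \<bullet> (L (r * r) *v u))"
        using L0[of r] by (metis add smult inner_add_right inner_scaleR_right inner_zero_right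
            matrix_vector_mult_0 matrix_vector_mult_add_rdistrib scaleR_matrix_vector_assoc)
      moreover have "(Im z)\<^sup>2 > 0" using im by simp
      ultimately show "u \<bullet> (L (r * r) *v u) = 0"
        using pos[of u ?c] pos[of u r]
        by (metis add_nonneg_eq_0_iff mult_eq_0_iff mult_nonneg_nonneg less_imp_le less_irrefl)
    qed
    from small[OF r this] show False by (simp add: d_def)
  qed
  define \<Lambda> where "\<Lambda> = {x. poly q x = 0}"
  define d where "d = (\<Prod>x\<in>\<Lambda>. [:-x, 1:])"
  have fin: "finite \<Lambda>" unfolding \<Lambda>_def using q(2) poly_roots_finite by blast
  have "d dvd q" unfolding d_def using fin by (rule prod_linear_dvd) (simp add: \<Lambda>_def)
  then obtain h where h: "q = d * h" by blast
  \<comment> \<open>A root of \<open>h\<close> would be a root of \<open>q\<close>, hence real and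
    in \<open>\<Lambda>\<close>, hence a double root of \<open>q\<close>.\<close>
  have "constant (poly (map_poly complex_of_real h))"
  proof (rule ccontr)
    assume "\<not> ?thesis"
    then obtain z where z: "poly (map_poly complex_of_real h) z = 0"
      using fundamental_theorem_of_algebra by blast
    have "poly (map_poly complex_of_real q) z = 0"
      unfolding h using z by (simp add: map_poly_of_real_mult)
    then have "z = complex_of_real (Re z)" using real by (simp add: complex_eq_iff)
    with z have hz: "poly h (Re z) = 0"
      by (metis poly_map_poly_of_real of_real_eq_0_iff)
    then have "Re z \<in> \<Lambda>" by (simp add: h \<Lambda>_def)
    then have "[:- Re z, 1:] dvd d" unfolding d_def using fin by (metis dvd_prodI)
    then obtain d' where "d = [:- Re z, 1:] * d'" by blast
    moreover obtain h' where "h = [:- Re z, 1:] * h'" using hz by (metis poly_eq_0_iff_dvd dvdE)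
    ultimately have "q = [:- Re z, 1:] * ([:- Re z, 1:] * (d' * h'))"
      unfolding h by (simp only: mult_ac)
    then show False by (rule simple)
  qed
  then have "degree h = 0"
    by (simp add: constant_degree degree_map_poly)
  then obtain c where c: "h = [:c:]" by (rule degree_eq_zeroE)
  have c0: "c \<noteq> 0" using q(2) unfolding h c by force
  have Lvanish: "L f = 0" if f: "\<And>x. x \<in> \<Lambda> \<Longrightarrow> poly f x = 0" for f
  proof -
    obtain g where g: "f = d * g"
      using prod_linear_dvd[OF fin f] by (auto simp: d_def)
    have "f = q * smult (inverse c) g"
      unfolding g h c using c0 by simp
    then show ?thesis by (simp only: L0)
  qed
  define l where "l x = smult (inverse (\<Prod>y\<in>\<Lambda> - {x}. x - y)) (\<Prod>y\<in>\<Lambda> - {x}. [:-y, 1:])" for x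
  have l: "poly (l x) y = (if y = x then 1 else 0)" if "x \<in> \<Lambda>" "y \<in> \<Lambda>" for x y
    using that fin by (auto simp: l_def poly_prod)
  \<comment> \<open>Squares of Lagrange polynomials take the same values on \<open>\<Lambda>\<close>
    as the polynomials themselves, and \<open>pos\<close> makes their images under \<open>L\<close>
    semidefinite.\<close>
  define A where "A x = L (l x * l x)" for x
  show thesis
  proof
    show "finite \<Lambda>" by fact
    show "0 \<notin> \<Lambda>" using nonzero by (simp add: \<Lambda>_def)
    show "psd_matrix (A x)" for x
      using pos sym by (auto simp: psd_matrix_def A_def)
    fix f
    have sumL: "L (\<Sum>x\<in>X. F x) = (\<Sum>x\<in>X. L (F x))" if "finite X" for F and X :: "real set"
      using that
    proof (induction X rule: finite_induct)
      case empty
      show ?case using smult[of 0 0] by simp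
    qed (simp add: add)
    let ?g = "\<Sum>x\<in>\<Lambda>. smult (poly f x) (l x * l x)"
    have "L (f + smult (-1) ?g) = 0"
    proof (rule Lvanish)
      fix y assume "y \<in> \<Lambda>"
      then have "poly ?g y = (\<Sum>x\<in>\<Lambda>. if y = x then poly f x else 0)"
        unfolding poly_sum by (intro sum.cong) (auto simp: l)
      then show "poly (f + smult (-1) ?g) y = 0"
        using \<open>y \<in> \<Lambda>\<close> fin by simp
    qed
    then have "L f = L ?g" by (simp only: add smult) simp
    also have "\<dots> = (\<Sum>x\<in>\<Lambda>. poly f x *\<^sub>R A x)"
      by (simp only: sumL[OF fin] smult A_def)
    finally show "L f = (\<Sum>x\<in>\<Lambda>. poly f x *\<^sub>R A x)" .
  qed
qed

subsection \<open>Symmetric extensions for semidefinite forms\<close>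

locale psd_form =
  fixes b :: "'v::real_vector \<Rightarrow> 'v \<Rightarrow> real"
  assumes add_left: "b (x + y) z = b x z + b y z"
    and scale_left: "b (c *\<^sub>R x) z = c * b x z"
    and commute: "b x y = b y x"
    and nonneg: "0 \<le> b x x"
begin

lemma add_right: "b z (x + y) = b z x + b z y"
  by (metis add_left commute)

lemma scale_right: "b z (c *\<^sub>R x) = c * b z x"
  by (metis scale_left commute)

lemma diff_left: "b (x - y) z = b x z - b y z"
  using add_left[of x "- 1 *\<^sub>R y" z] by (simp only: scale_left) simp

lemma diff_right: "b z (x - y) = b z x - b z y"
  by (metis diff_left commute)

lemma zero_left: "b 0 z = 0"
  using scale_left[of 0 0 z] by simp

lemma sum_left: "b (\<Sum>i\<in>I. f i) z = (\<Sum>i\<in>I. b (f i) z)"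
  by (induction I rule: infinite_finite_induct) (simp_all add: add_left zero_left)

lemmas bilinear_simps = add_left add_right scale_left scale_right diff_left diff_right

text \<open>The degenerate case of Cauchy-Schwarz: null vectors are orthogonal to
  everything.\<close>

lemma null:
  assumes "b x x = 0"
  shows "b x y = 0"
proof -
  have "0 \<le> b y y + t * (2 * b x y)" for t
    using nonneg[of "y + t *\<^sub>R x"] assms by (simp add: bilinear_simps commute[of y x])
  then show ?thesis
    using affine_nonneg_slope_zero by (metis mult_eq_0_iff zero_neq_numeral)
qed

lemma null_iff_diff:
  assumes "b (x - y) (x - y) = 0"
  shows "b x x = 0 \<longleftrightarrow> b y y = 0"
  using null[OF assms, of x] null[OF assms, of y] by (simp add: diff_left commute[of x y])

text \<open>Induction by Gram-Schmidt: the new vector \<open>a\<close> is replaced by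
  \<open>a'\<close>, orthogonal to \<open>span B\<close>, and the representing vector gains a
  multiple of \<open>a'\<close>. As the form may be degenerate, \<open>\<phi>\<close> has to vanish
  on null vectors.\<close>

lemma riesz_span:
  assumes "finite B" "linear \<phi>"
    and "\<And>u. u \<in> span B \<Longrightarrow> b u u = 0 \<Longrightarrow> \<phi> u = 0"
  shows "\<exists>w\<in>span B. \<forall>u\<in>span B. b w u = \<phi> u"
  using assms
proof (induction B arbitrary: \<phi> rule: finite_induct)
  case empty
  then show ?case by (auto simp: zero_left linear_0)
next
  case (insert a B)
  have lin_b: "linear (b a)" by (intro linearI) (auto simp: add_right scale_right)
  obtain w where w: "w \<in> span B" "\<And>u. u \<in> span B \<Longrightarrow> b w u = \<phi> u"
    using insert.IH[of \<phi>] insert.prems by (meson span_mono subset_insertI subsetD)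
  obtain w0 where w0: "w0 \<in> span B" "\<And>u. u \<in> span B \<Longrightarrow> b w0 u = b a u"
    using insert.IH[OF lin_b] null by (metis commute)
  define a' where "a' = a - w0"
  have a': "b a' u = 0" "b u a' = 0" if "u \<in> span B" for u
    using w0(2)[OF that] by (auto simp: a'_def diff_left diff_right commute[of u])
  have a'_span: "a' \<in> span (insert a B)"
    unfolding a'_def using w0(1) by (meson insertI1 span_base span_diff span_mono subsetD subset_insertI)
  \<comment> \<open>If \<open>a'\<close> is null, the quotient is 0 by convention, and the identity
    for \<open>c\<close> still holds because then \<open>\<phi> a' = 0\<close>.\<close>
  define c where "c = \<phi> a' / b a' a'"
  have c: "c * b a' a' = \<phi> a'"
    using insert.prems(2)[OF a'_span] by (auto simp: c_def)
  show ?case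
  proof (intro bexI[of _ "w + c *\<^sub>R a'"] ballI)
    show "w + c *\<^sub>R a' \<in> span (insert a B)"
      using w(1) a'_span by (meson span_add span_mono span_scale subsetD subset_insertI)
    fix u assume "u \<in> span (insert a B)"
    then obtain k where k: "u - k *\<^sub>R a \<in> span B"
      by (auto simp: span_insert)
    define v where "v = u - k *\<^sub>R a'"
    have "v = (u - k *\<^sub>R a) + k *\<^sub>R w0"
      by (simp add: v_def a'_def algebra_simps)
    then have v: "v \<in> span B" using k w0(1) by (metis span_add span_scale)
    have u: "u = v + k *\<^sub>R a'" by (simp add: v_def)
    have "b (w + c *\<^sub>R a') u = b w v + k * (c * b a' a')"
      unfolding u using a'(1)[OF v] a'(2)[OF w(1)] by (simp add: bilinear_simps)
    also have "\<dots> = \<phi> u"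
      unfolding u c w(2)[OF v] using insert.prems(1) by (simp add: linear_add linear_scale)
    finally show "b (w + c *\<^sub>R a') u = \<phi> u" .
  qed
qed

end

text \<open>\<open>U\<close> is the domain of the operator \<open>X\<close>; \<open>\<rho>\<close>
  and \<open>E\<close> describe vectors modulo \<open>U\<close> by finitely many coordinates. In
  \<open>X_null\<close>, one direction makes \<open>X\<close> well defined modulo null vectors, the
  other makes it injective there. Through \<open>B\<close>, the domain has finite dimension modulo
  null vectors, although \<open>'v\<close> may be infinite-dimensional.\<close>

locale symmetric_partial_operator = psd_form b
  for b :: "'v::real_vector \<Rightarrow> 'v \<Rightarrow> real" +
  fixes U :: "'v set" and B :: "'v set" and X :: "'v \<Rightarrow> 'v"
    and \<rho> :: "'v \<Rightarrow> 'a::euclidean_space" and E :: "'a \<Rightarrow> 'v"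
  assumes subspace_U: "subspace U"
    and finite_B: "finite B" and B_U: "B \<subseteq> U"
    and span_B: "u \<in> U \<Longrightarrow> \<exists>w\<in>span B. b (u - w) (u - w) = 0"
    and linear_X: "linear X"
    and X_sym: "u \<in> U \<Longrightarrow> v \<in> U \<Longrightarrow> b (X u) v = b u (X v)"
    and X_null: "u \<in> U \<Longrightarrow> b (X u) (X u) = 0 \<longleftrightarrow> b u u = 0"
    and linear_\<rho>: "linear \<rho>" and linear_E: "linear E"
    and complement: "v - E (\<rho> v) \<in> U"
    and \<rho>_U: "u \<in> U \<Longrightarrow> \<rho> u = 0"
begin

text \<open>\<open>span B\<close> exhausts \<open>U\<close> up to null vectors, on which both
  \<open>b w\<close> and \<open>\<phi>\<close> vanish.\<close>

lemma riesz:
  assumes "linear \<phi>" and "\<And>u. u \<in> U \<Longrightarrow> b u u = 0 \<Longrightarrow> \<phi> u = 0"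
  shows "\<exists>w\<in>U. \<forall>u\<in>U. b w u = \<phi> u"
proof -
  have span_U: "span B \<subseteq> U" using B_U subspace_U by (rule span_minimal)
  obtain w where w: "w \<in> span B" "\<And>u. u \<in> span B \<Longrightarrow> b w u = \<phi> u"
    using riesz_span[OF finite_B assms(1)] assms(2) span_U by blast
  have "b w u = \<phi> u" if u: "u \<in> U" for u
  proof -
    obtain v where v: "v \<in> span B" "b (u - v) (u - v) = 0"
      using span_B[OF u] by blast
    have "u - v \<in> U" using u v span_U subspace_U by (meson subsetD subspace_diff)
    then have "\<phi> (u - v) = 0" using assms(2) v by blast
    moreover have "b w (u - v) = 0" using null[OF v(2)] by (metis commute)
    ultimately show ?thesis
      using w(2)[OF v(1)] assms(1) by (simp add: diff_right linear_diff)
  qed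
  then show ?thesis using w(1) span_U by blast
qed

text \<open>Representing vectors are not unique, so they are chosen for a basis of parameters and
  extended linearly.\<close>

lemma riesz_family:
  fixes \<phi> :: "'a \<Rightarrow> 'v \<Rightarrow> real"
  assumes "\<And>y. linear (\<phi> y)" "\<And>u. linear (\<lambda>y. \<phi> y u)"
    and "\<And>y u. u \<in> U \<Longrightarrow> b u u = 0 \<Longrightarrow> \<phi> y u = 0"
  obtains W where "linear W" "\<And>y. W y \<in> U" "\<And>y u. u \<in> U \<Longrightarrow> b (W y) u = \<phi> y u"
proof -
  have "\<forall>y. \<exists>w. w \<in> U \<and> (\<forall>u\<in>U. b w u = \<phi> y u)"
    using riesz[OF assms(1)] assms(3) by blast
  then obtain w where w: "\<And>y. w y \<in> U" "\<And>y u. u \<in> U \<Longrightarrow> b (w y) u = \<phi> y u"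
    by metis
  define W where "W y = (\<Sum>i\<in>Basis. (y \<bullet> i) *\<^sub>R w i)" for y
  show thesis
  proof
    show "linear W"
      by (intro linearI) (simp_all add: W_def inner_add_left scaleR_add_left sum.distrib scaleR_sum_right)
    show "W y \<in> U" for y
      unfolding W_def using subspace_U w(1) by (intro subspace_sum subspace_scale) auto
    fix y u assume u: "u \<in> U"
    have "b (W y) u = (\<Sum>i\<in>Basis. (y \<bullet> i) * \<phi> i u)"
      by (simp add: W_def sum_left scale_left w(2)[OF u])
    also have "\<dots> = \<phi> (\<Sum>i\<in>Basis. (y \<bullet> i) *\<^sub>R i) u"
      using linear_sum[OF assms(2), of "\<lambda>i. (y \<bullet> i) *\<^sub>R i" Basis u] linear_scale[OF assms(2), of _ _ u] by simp
    finally show "b (W y) u = \<phi> y u" by (simp add: euclidean_representation)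
  qed
qed

text \<open>In block form with respect to \<open>U\<close> and its orthogonal complement (parametrised by \<open>g\<close>), the
  extension has \<open>X\<close> in the first column, the adjoint forced by symmetry, and \<open>t\<close> times the identity
  in the corner.  Kernel vectors for distinct \<open>t\<close> have orthogonal complement parts, so all but
  finitely many \<open>t\<close> give an injective extension.\<close>

lemma symmetric_injective_extension:
  obtains T where "linear T" "\<And>u v. b (T u) v = b u (T v)" "\<And>u. u \<in> U \<Longrightarrow> T u = X u"
    "\<And>v. b (T v) (T v) = 0 \<Longrightarrow> b v v = 0"
proof -
  \<comment> \<open>\<open>W y\<close> is a projection of \<open>E y\<close> to \<open>U\<close>, so
    that \<open>g y\<close> below is orthogonal to \<open>U\<close>.\<close>
  obtain W where W: "linear W" "\<And>y. W y \<in> U" "\<And>y u. u \<in> U \<Longrightarrow> b (W y) u = b (E y) u"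
  proof (rule riesz_family[of "\<lambda>y. b (E y)"])
    show "linear (b (E y))" for y by (intro linearI) (auto simp: bilinear_simps)
    show "linear (\<lambda>y. b (E y) u)" for u
      using linear_E by (intro linearI) (auto simp: bilinear_simps linear_add linear_scale)
    show "b (E y) u = 0" if "b u u = 0" for y u
      using null[OF that] by (metis commute)
  qed blast
  define g where "g y = E y - W y" for y
  have g_linear: "linear g"
    unfolding g_def using linear_E W(1) by (rule linear_compose_sub)
  have g_orth: "b (g y) u = 0" "b u (g y) = 0" if "u \<in> U" for y u
    using W(3)[OF that, of y] by (auto simp: g_def bilinear_simps commute[of u])
  \<comment> \<open>\<open>Z\<close> is the adjoint of the part of \<open>X\<close> that leads from
    \<open>U\<close> to the complement.\<close>
  obtain Z where Z: "linear Z" "\<And>y. Z y \<in> U" "\<And>y u. u \<in> U \<Longrightarrow> b (Z y) u = b (g y) (X u)"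
  proof (rule riesz_family[of "\<lambda>y u. b (g y) (X u)"])
    show "linear (\<lambda>u. b (g y) (X u))" for y
      using linear_X by (intro linearI) (auto simp: bilinear_simps linear_add linear_scale)
    show "linear (\<lambda>y. b (g y) (X u))" for u
      using g_linear by (intro linearI) (auto simp: bilinear_simps linear_add linear_scale)
    show "b (g y) (X u) = 0" if "u \<in> U" "b u u = 0" for y u
      using null[of "X u" "g y"] X_null that commute by metis
  qed blast
  \<comment> \<open>\<open>Q v\<close> and \<open>g (\<rho> v)\<close> are the components of
    \<open>v\<close> in \<open>U\<close> and in its orthogonal complement.\<close>
  define Q where "Q v = v - g (\<rho> v)" for v
  have Q_U: "Q v \<in> U" for v
    using complement[of v] W(2)[of "\<rho> v"] subspace_U subspace_add
    by (fastforce simp: Q_def g_def algebra_simps)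
  have Q_linear: "linear Q"
    unfolding Q_def using g_linear linear_\<rho>
    by (intro linear_compose_sub linear_compose[unfolded o_def, of \<rho> g]) (auto simp: linear_id[unfolded id_def])
  have split: "v = Q v + g (\<rho> v)" for v by (simp add: Q_def)
  define T where "T t v = X (Q v) + (Z (\<rho> v) + t *\<^sub>R g (\<rho> v))" for t v
  have T_linear: "linear (T t)" for t
    using linear_X Q_linear Z(1) g_linear linear_\<rho>
    by (intro linearI) (simp_all add: T_def linear_add linear_scale algebra_simps)
  have T_form: "b (T t u) v = b (X (Q u)) (Q v) + b (X (Q u)) (g (\<rho> v)) + b (g (\<rho> u)) (X (Q v)) +
      t * b (g (\<rho> u)) (g (\<rho> v))" for t u v
  proof -
    have "b (T t u) v = b (T t u) (Q v + g (\<rho> v))" using split by simp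
    then show ?thesis
      using Z(2)[of "\<rho> u"] Z(3)[OF Q_U, of "\<rho> u" v] Q_U[of v]
      by (simp add: T_def bilinear_simps g_orth)
  qed
  have T_sym: "b (T t u) v = b u (T t v)" for t u v
    using T_form[of t u v] T_form[of t v u] X_sym[OF Q_U Q_U, of u v]
    by (simp add: commute)
  have T_X: "T t u = X u" if "u \<in> U" for t u
    using \<rho>_U[OF that] Z(1) g_linear by (simp add: T_def Q_def linear_0)
  have "\<exists>t. \<forall>v. b (T t v) (T t v) = 0 \<longrightarrow> b v v = 0"
  proof (rule ccontr)
    assume "\<not> ?thesis"
    then obtain v where v: "\<And>t. b (T t (v t)) (T t (v t)) = 0" "\<And>t. b (v t) (v t) \<noteq> 0"
      by metis
    \<comment> \<open>\<open>G s t\<close> pairs the complement parts of the bad vectors for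
      \<open>s\<close> and \<open>t\<close>. As \<open>T s (v s)\<close> and
      \<open>T t (v t)\<close> are null, \<open>T_form\<close> yields
      \<open>s * G s t = t * G t s\<close>: the terms without parameter agree by symmetry.\<close>
    define G where "G s t = b (g (\<rho> (v s))) (g (\<rho> (v t)))" for s t
    have G_orth: "G s t = 0" if "s \<noteq> t" for s t
    proof -
      have "b (T s (v s)) (v t) = 0" "b (T t (v t)) (v s) = 0"
        using null v(1) by blast+
      then have "s * G s t = t * G t s"
        using T_form[of s "v s" "v t"] T_form[of t "v t" "v s"] X_sym[OF Q_U Q_U, of "v s" "v t"]
          commute[of "X (Q (v t))"] commute[of "X (Q (v s))" "g (\<rho> (v t))"]
        by (simp add: G_def)
      moreover have "G t s = G s t" by (simp add: G_def commute)
      ultimately show ?thesis using that by simp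
    qed
    \<comment> \<open>If the complement part of \<open>v t\<close> were null, \<open>v t\<close>
      would agree with \<open>Q (v t)\<close> up to a null vector, and \<open>X_null\<close> would
      make \<open>v t\<close> null.\<close>
    have G_pos: "G t t \<noteq> 0" for t
    proof
      assume "G t t = 0"
      let ?g = "g (\<rho> (v t))"
      have g0: "b ?g ?g = 0" using \<open>G t t = 0\<close> by (simp add: G_def)
      have "b (T t ?g) (T t ?g) = b ?g (T t (T t ?g))" by (rule T_sym)
      then have Tg0: "b (T t ?g) (T t ?g) = 0" using null[OF g0] by simp
      have d: "v t - Q (v t) = ?g" by (simp add: Q_def)
      have "T t (v t) - T t (Q (v t)) = T t ?g"
        using d T_linear by (metis linear_diff)
      then have "b (X (Q (v t))) (X (Q (v t))) = 0"
        using null_iff_diff[of "T t (v t)" "T t (Q (v t))"] Tg0 v(1) T_X[OF Q_U] by simp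
      then have "b (Q (v t)) (Q (v t)) = 0" using X_null[OF Q_U] by simp
      then show False
        using null_iff_diff[of "v t" "Q (v t)"] g0 d v(2) by simp
    qed
    \<comment> \<open>The real parameters would index infinitely many independent vectors of the
      Euclidean space \<open>'a\<close>.\<close>
    define Y where "Y = range (\<lambda>t::real. \<rho> (v t))"
    have inj: "inj (\<lambda>t. \<rho> (v t))"
      by (rule injI) (metis G_def G_orth G_pos)
    have "independent Y"
      unfolding real_vector.independent_explicit_module
    proof (intro allI impI)
      fix C c y assume C: "finite C" "C \<subseteq> Y" "(\<Sum>y\<in>C. c y *\<^sub>R y) = 0" "y \<in> C"
      then obtain s where s: "y = \<rho> (v s)" by (auto simp: Y_def)
      have orth: "b (g x) (g y) = 0" if "x \<in> C - {y}" for x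
      proof -
        obtain t where "x = \<rho> (v t)" using \<open>x \<in> C - {y}\<close> C(2) by (auto simp: Y_def)
        with that s G_orth[of t s] show ?thesis by (auto simp: G_def)
      qed
      have "0 = b (g (\<Sum>x\<in>C. c x *\<^sub>R x)) (g y)"
        unfolding C(3) using g_linear by (simp add: linear_0 zero_left)
      also have "\<dots> = (\<Sum>x\<in>C. c x * b (g x) (g y))"
        using g_linear by (simp add: linear_sum linear_scale sum_left scale_left)
      also have "\<dots> = c y * b (g y) (g y)"
        using C(1,4) orth by (subst sum.remove[of _ y]) auto
      finally show "c y = 0"
        using G_pos[of s] by (simp add: G_def s)
    qed
    then have "finite Y" using independent_bound by blast
    then show False
      using inj finite_imageD unfolding Y_def by (metis infinite_UNIV_char_0)
  qed
  then obtain t where "\<forall>v. b (T t v) (T t v) = 0 \<longrightarrow> b v v = 0" by blast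
  with T_linear T_sym T_X that show thesis by blast
qed

end

subsection \<open>Block Hankel forms\<close>

text \<open>Block vectors are plain sequences; this instance lets the locales above apply to
  them.\<close>

instantiation "fun" :: (type, real_vector) real_vector
begin

definition "c *\<^sub>R f = (\<lambda>x. c *\<^sub>R f x)"

instance
  by standard (simp_all add: scaleR_fun_def fun_eq_iff scaleR_add_right scaleR_add_left)

end

lemma scaleR_fun_apply [simp]: "(c *\<^sub>R f) x = c *\<^sub>R f x"
  by (simp add: scaleR_fun_def)

lemma sum_fun_apply: "(\<Sum>i\<in>I. f i) x = (\<Sum>i\<in>I. f i x)"
  by (induction I rule: infinite_finite_induct) simp_all

section \<open>Polynomials in a linear operator\<close>

definition poly_op :: "('v::real_vector \<Rightarrow> 'v) \<Rightarrow> real poly \<Rightarrow> 'v \<Rightarrow> 'v" where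
  "poly_op T f v = (\<Sum>k\<le>degree f. coeff f k *\<^sub>R (T ^^ k) v)"

lemma poly_op_0 [simp]: "poly_op T 0 v = 0"
  by (simp add: poly_op_def)

context
  fixes T :: "'v::real_vector \<Rightarrow> 'v"
  assumes T: "linear T"
begin

lemma poly_op_pCons [simp]: "poly_op T (pCons a f) v = a *\<^sub>R v + T (poly_op T f v)"
proof (cases "f = 0")
  case True
  then show ?thesis using T by (simp add: poly_op_def linear_0)
next
  case False
  then show ?thesis
    using T by (simp add: poly_op_def sum.atMost_Suc_shift linear_sum linear_scale del: sum.atMost_Suc)
qed

lemma poly_op_add: "poly_op T (f + g) v = poly_op T f v + poly_op T g v"
proof (induction f arbitrary: g)
  case (pCons a f)
  then show ?case
    using T by (cases g) (simp add: linear_add scaleR_add_left)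
qed simp

lemma poly_op_smult: "poly_op T (smult c f) v = c *\<^sub>R poly_op T f v"
  using T by (induction f) (simp_all add: linear_scale scaleR_add_right)

lemma poly_op_mult: "poly_op T (f * g) v = poly_op T f (poly_op T g v)"
  by (induction f) (simp_all add: poly_op_add poly_op_smult)

lemma poly_op_linear: "linear (poly_op T f)"
proof (induction f)
  case 0
  then show ?case by (simp add: linear_iff)
next
  case (pCons a f)
  then show ?case
    using T by (intro linearI) (simp_all add: linear_add linear_scale algebra_simps)
qed

lemma poly_op_monom: "poly_op T (monom 1 k) v = (T ^^ k) v"
  by (induction k) (use T in \<open>simp_all add: monom_0 monom_Suc linear_0\<close>)

lemma poly_op_commute: "poly_op T f (T v) = T (poly_op T f v)"
  by (induction f) (use T in \<open>simp_all add: linear_add linear_scale linear_0\<close>)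

end

lemma (in psd_form) poly_op_sym:
  assumes "linear T" "\<And>u v. b (T u) v = b u (T v)"
  shows "b (poly_op T f u) v = b u (poly_op T f v)"
  by (induction f arbitrary: u v) (simp_all add: zero_left commute[of _ 0] poly_op_pCons[OF assms(1)] poly_op_commute[OF assms(1)] bilinear_simps assms(2))

lemma matrix_eqI_inner:
  fixes A B :: "real^'n^'m"
  assumes "\<And>x y. x \<bullet> (A *v y) = x \<bullet> (B *v y)"
  shows "A = B"
  using assms vector_eq_ldot unfolding matrix_eq by blast

lemma inner_matrix_vector:
  fixes A :: "real^'n^'m"
  shows "x \<bullet> (A *v y) = (\<Sum>i\<in>UNIV. \<Sum>j\<in>UNIV. x $ i * (y $ j * A $ i $ j))"
  by (simp add: inner_vec_def matrix_vector_mult_def sum_distrib_left mult_ac)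

lemma (in psd_form) matrix_of_form:
  fixes E :: "real^'p \<Rightarrow> 'v"
  assumes E: "linear E" and S: "linear S"
  shows "x \<bullet> ((\<chi> i j. b (E (axis i 1)) (S (E (axis j 1)))) *v y) = b (E x) (S (E y))"
proof -
  have expand: "z = (\<Sum>i\<in>UNIV. (z $ i) *\<^sub>R axis i 1)" for z :: "real^'p"
    using basis_expansion[of z] by (simp add: scalar_mult_eq_scaleR)
  have "b (E x) (S (E y)) = b (E (\<Sum>i\<in>UNIV. (x $ i) *\<^sub>R axis i 1)) (S (E (\<Sum>i\<in>UNIV. (y $ i) *\<^sub>R axis i 1)))"
    using expand[of x] expand[of y] by simp
  also have "\<dots> = b (\<Sum>i\<in>UNIV. (x $ i) *\<^sub>R E (axis i 1)) (\<Sum>i\<in>UNIV. (y $ i) *\<^sub>R S (E (axis i 1)))"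
    using E S by (simp add: linear_sum linear_scale)
  also have "\<dots> = (\<Sum>i\<in>UNIV. x $ i * (\<Sum>j\<in>UNIV. y $ j * b (S (E (axis j 1))) (E (axis i 1))))"
    by (simp add: sum_left scale_left commute[of "E (axis _ 1)" "sum _ _"])
  also have "\<dots> = x \<bullet> ((\<chi> i j. b (E (axis i 1)) (S (E (axis j 1)))) *v y)"
    by (simp add: inner_matrix_vector sum_distrib_left commute)
  finally show ?thesis by simp
qed

section \<open>Block Hankel forms and the shift\<close>

definition block_form :: "nat \<Rightarrow> (nat \<Rightarrow> real^'p^'p) \<Rightarrow> (nat \<Rightarrow> real^'p) \<Rightarrow> (nat \<Rightarrow> real^'p) \<Rightarrow> real" where
  "block_form N s v w = (\<Sum>r<N. \<Sum>c<N. v r \<bullet> (s (r + c) *v w c))"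

text \<open>With a block vector read as the coefficients of a vector-valued polynomial, this is
  multiplication by the variable.\<close>

definition shift :: "(nat \<Rightarrow> 'a::zero) \<Rightarrow> nat \<Rightarrow> 'a" where
  "shift v = case_nat 0 v"

lemma shift_simps [simp]: "shift v 0 = 0" "shift v (Suc k) = v k"
  by (simp_all add: shift_def)

definition single :: "nat \<Rightarrow> 'a::zero \<Rightarrow> nat \<Rightarrow> 'a" where
  "single k y = (\<lambda>m. if m = k then y else 0)"

lemma linear_single: "linear (single k :: 'a::real_vector \<Rightarrow> _)"
  by (intro linearI) (auto simp: single_def fun_eq_iff)

lemma block_form_eq_0: "(\<And>r. r < N \<Longrightarrow> v r = 0) \<Longrightarrow> block_form N s v w = 0"
  by (simp add: block_form_def)

lemma block_form_single:
  assumes "k < N" "l < N"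
  shows "block_form N s (single k y) (single l z) = y \<bullet> (s (k + l) *v z)"
proof -
  have "block_form N s (single k y) (single l z) =
      (\<Sum>r<N. if r = k then (\<Sum>c<N. if c = l then y \<bullet> (s (k + l) *v z) else 0) else 0)"
    unfolding block_form_def single_def
    by (intro sum.cong refl) (auto simp: if_distrib[of "(*v) _"] if_distrib[of "(\<bullet>) _"] cong: if_cong)
  then show ?thesis using assms by simp
qed

lemma block_form_restrict:
  assumes "v N = 0" "w N = 0"
  shows "block_form (Suc N) s v w = block_form N s v w"
  using assms by (simp add: block_form_def)

text \<open>By the Hankel structure a shift of either argument raises the index of \<open>s\<close>
  by one. With \<open>block_form_shift_right\<close> this makes the shift symmetric on vectors with
  vanishing block \<open>N\<close>.\<close>

lemma block_form_shift_left:
  assumes "w N = 0"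
  shows "block_form (Suc N) s (shift v) w = block_form N (\<lambda>k. s (Suc k)) v w"
proof -
  have "(\<Sum>c<Suc N. x \<bullet> (s (k + c) *v w c)) = (\<Sum>c<N. x \<bullet> (s (k + c) *v w c))" for x k
    using assms by simp
  then show ?thesis
    by (simp add: block_form_def sum.lessThan_Suc_shift[of _ N] del: sum.lessThan_Suc)
qed

lemma block_form_shift_right:
  assumes "v N = 0"
  shows "block_form (Suc N) s v (shift w) = block_form N (\<lambda>k. s (Suc k)) v w"
proof -
  have "(\<Sum>c<Suc N. v r \<bullet> (s (r + c) *v shift w c)) = (\<Sum>c<N. v r \<bullet> (s (Suc (r + c)) *v w c))" for r
    by (simp add: sum.lessThan_Suc_shift del: sum.lessThan_Suc)
  then show ?thesis using assms by (simp add: block_form_def)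
qed

text \<open>Identifies the second form of the kernel condition as the large form at shifted vectors,
  which turns the condition into \<open>X_null\<close>.\<close>

lemma block_form_shift_both:
  "block_form (Suc N) s (shift v) (shift w) = block_form N (\<lambda>k. s (k + 2)) v w"
  by (simp add: block_form_def sum.lessThan_Suc_shift del: sum.lessThan_Suc)

lemma psd_form_block_form:
  fixes s :: "nat \<Rightarrow> real^'p^'p"
  assumes sym: "\<And>r c. r < N \<Longrightarrow> c < N \<Longrightarrow> transpose (s (r + c)) = s (r + c)"
    and nonneg: "\<And>v. 0 \<le> block_form N s v v"
  shows "psd_form (block_form N s)"
proof
  show "block_form N s (x + y) z = block_form N s x z + block_form N s y z" for x y z
    by (simp add: block_form_def inner_add_left sum.distrib)
  show "block_form N s (c *\<^sub>R x) z = c * block_form N s x z" for c x z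
    by (simp add: block_form_def sum_distrib_left)
  show "block_form N s x y = block_form N s y x" for x y
  proof -
    have "block_form N s x y = (\<Sum>r<N. \<Sum>c<N. y c \<bullet> (s (c + r) *v x r))"
      unfolding block_form_def
      by (intro sum.cong refl) (auto simp: add.commute intro!: symmetric_inner_matrix sym[simplified add.commute])
    also have "\<dots> = block_form N s y x" unfolding block_form_def by (rule sum.swap)
    finally show ?thesis .
  qed
  show "0 \<le> block_form N s x x" for x by (rule nonneg)
qed

text \<open>\<open>L f\<close> is the compression of \<open>poly_op T f\<close> to the first block,
  where \<open>T\<close> extends the shift. Powers of \<open>T\<close> move the first block through
  the blocks up to \<open>N\<close>, so \<open>L\<close> returns \<open>s k\<close> on monomials of
  degree up to \<open>2 * N\<close>.\<close>

proposition hankel_atomic_representation: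
  fixes s :: "nat \<Rightarrow> real^'p^'p"
  assumes sym: "\<And>k. k \<le> 2 * N \<Longrightarrow> transpose (s k) = s k"
    and psd: "\<And>v. 0 \<le> block_form (Suc N) s v v"
    and null_iff: "\<And>v. block_form N s v v = 0 \<longleftrightarrow> block_form N (\<lambda>k. s (k + 2)) v v = 0"
  obtains \<Lambda> A where "finite \<Lambda>" "0 \<notin> \<Lambda>" "\<And>x. psd_matrix (A x)"
    "\<And>k. k \<le> 2 * N \<Longrightarrow> s k = (\<Sum>x\<in>\<Lambda>. x ^ k *\<^sub>R A x)"
proof -
  let ?b = "block_form (Suc N) s"
  interpret psd_form ?b
    by (intro psd_form_block_form sym psd) simp
  let ?B = "(\<lambda>(k, i). single k i) ` ({..<N} \<times> (Basis :: (real^'p) set))"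
  interpret symmetric_partial_operator ?b "{v. v N = 0}" ?B shift "\<lambda>v. v N" "single N"
  proof (intro symmetric_partial_operator.intro symmetric_partial_operator_axioms.intro)
    show "psd_form ?b" by (rule psd_form_axioms)
    show "subspace {v :: nat \<Rightarrow> real^'p. v N = 0}" by (auto simp: subspace_def)
    show "finite ?B" by simp
    show "?B \<subseteq> {v. v N = 0}" by (auto simp: single_def)
    show "linear (shift :: (nat \<Rightarrow> real^'p) \<Rightarrow> _)"
      by (intro linearI) (auto simp: shift_def fun_eq_iff split: nat.split)
    show "linear (\<lambda>v :: nat \<Rightarrow> real^'p. v N)" by (intro linearI) auto
    show "linear (single N :: real^'p \<Rightarrow> _)" by (rule linear_single)
    show "v - single N (v N) \<in> {v. v N = 0}" for v :: "nat \<Rightarrow> real^'p"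
      by (simp add: single_def)
    show "u N = 0" if "u \<in> {v. v N = 0}" for u :: "nat \<Rightarrow> real^'p" using that by simp
    fix u :: "nat \<Rightarrow> real^'p" assume u: "u \<in> {v. v N = 0}"
    then show "?b (shift u) (shift u) = 0 \<longleftrightarrow> ?b u u = 0"
      using null_iff[of u] by (simp add: block_form_shift_both block_form_restrict)
    show "?b (shift u) v = ?b u (shift v)" if "v \<in> {v. v N = 0}" for v
      using u that by (simp add: block_form_shift_left block_form_shift_right)
    show "\<exists>w\<in>span ?B. ?b (u - w) (u - w) = 0"
    proof (intro bexI)
      \<comment> \<open>\<open>?w\<close> copies the blocks of \<open>u\<close> below
        \<open>N\<close>. As \<open>u N = 0\<close>, the difference vanishes on all blocks up to
        \<open>N\<close> and is null whatever its later blocks are.\<close>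
      let ?w = "\<Sum>k<N. \<Sum>i\<in>Basis. (u k \<bullet> i) *\<^sub>R single k i"
      show "?w \<in> span ?B"
        by (intro span_sum span_scale span_base) auto
      have "?w r = (if r < N then u r else 0)" for r
      proof -
        have "?w r = (\<Sum>k<N. \<Sum>i\<in>Basis. (u k \<bullet> i) *\<^sub>R single k i r)"
          by (simp only: sum_fun_apply scaleR_fun_apply)
        also have "\<dots> = (\<Sum>k<N. if k = r then u r else 0)"
          by (intro sum.cong refl) (auto simp: single_def euclidean_representation)
        finally show ?thesis by simp
      qed
      then have "(u - ?w) r = 0" if "r < Suc N" for r
        using u that by (cases "r = N") auto
      then show "?b (u - ?w) (u - ?w) = 0"
        by (rule block_form_eq_0)
    qed
  qed
  obtain T where T: "linear T" "\<And>u v. ?b (T u) v = ?b u (T v)"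
    "\<And>u. u N = 0 \<Longrightarrow> T u = shift u" "\<And>v. ?b (T v) (T v) = 0 \<Longrightarrow> ?b v v = 0"
    using symmetric_injective_extension by auto
  note op = poly_op_add[OF T(1)] poly_op_smult[OF T(1)] poly_op_mult[OF T(1)] poly_op_monom[OF T(1)]
  note op_sym = poly_op_sym[OF T(1,2)]
  define e where "e = (single 0 :: real^'p \<Rightarrow> _)"
  have e: "linear e" unfolding e_def by (rule linear_single)
  define L where "L f = (\<chi> i j. ?b (e (axis i 1)) (poly_op T f (e (axis j 1))))" for f
  have L: "x \<bullet> (L f *v y) = ?b (e x) (poly_op T f (e y))" for f x y
    unfolding L_def using e poly_op_linear[OF T(1)] by (rule matrix_of_form)
  have L_add: "L (f + g) = L f + L g" for f g
    by (rule matrix_eqI_inner) (simp add: matrix_vector_mult_add_rdistrib inner_add_right L op add_right)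
  have L_smult: "L (smult c f) = c *\<^sub>R L f" for c f
    by (rule matrix_eqI_inner) (simp add: L op scale_right flip: scaleR_matrix_vector_assoc)
  have L_mult: "x \<bullet> (L (f * g) *v y) = ?b (poly_op T f (e x)) (poly_op T g (e y))" for f g x y
    by (simp add: L op op_sym)
  have L_sym: "transpose (L f) = L f" for f
    by (rule matrix_eqI_inner) (metis L commute dot_lmul_matrix inner_commute op_sym transpose_matrix_vector)
  have L_ann: "\<exists>q. q \<noteq> 0 \<and> (\<forall>f. L (q * f) = 0)"
  proof -
    \<comment> \<open>The blocks \<open>0\<close> to \<open>N\<close> of \<open>poly_op T q\<close>
      at the embedded unit vectors amount to finitely many linear functionals of \<open>q\<close>. A
      common zero \<open>q\<close> makes these vectors null, and symmetry of \<open>T\<close> then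
      gives \<open>L (q * f) = 0\<close>.\<close>
    let ?I = "(UNIV :: 'p set) \<times> {..N} \<times> (UNIV :: 'p set)"
    obtain h where h: "bij_betw h {0..<card ?I} ?I"
      using ex_bij_betw_nat_finite[of ?I] by auto
    define \<phi> where "\<phi> n q = (case h n of (j, k, i) \<Rightarrow> poly_op T q (e (axis j 1)) k $ i)" for n q
    have "\<exists>q. q \<noteq> 0 \<and> (\<forall>n<card ?I. \<phi> n q = 0)"
      by (rule common_kernel_poly) (auto simp: \<phi>_def op split: prod.split)
    then obtain q where q: "q \<noteq> 0" "\<And>n. n < card ?I \<Longrightarrow> \<phi> n q = 0" by blast
    have q0: "poly_op T q (e (axis j 1)) k = 0" if "k \<le> N" for j k
    proof (rule vec_eq_iff[THEN iffD2], rule allI)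
      fix i
      have "(j, k, i) \<in> h ` {0..<card ?I}" using h that by (auto simp: bij_betw_def)
      then obtain n where "n < card ?I" "h n = (j, k, i)" by auto
      with q(2)[of n] show "poly_op T q (e (axis j 1)) k $ i = 0 $ i"
        by (simp add: \<phi>_def)
    qed
    have "?b (e (axis i 1)) (poly_op T q v) = 0" for i v
      unfolding op_sym[symmetric] using q0 by (intro block_form_eq_0) simp
    then have "L (q * f) = 0" for f
      by (simp add: L_def vec_eq_iff op)
    with q(1) show ?thesis by blast
  qed
  obtain \<Lambda> A where \<Lambda>: "finite \<Lambda>" "0 \<notin> \<Lambda>" "\<And>x. psd_matrix (A x)"
    "\<And>f. L f = (\<Sum>x\<in>\<Lambda>. poly f x *\<^sub>R A x)"
  proof (rule positive_functional_atomic[OF L_add L_smult L_sym _ L_ann])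
    show "0 \<le> u \<bullet> (L (f * f) *v u)" for f u by (simp add: L_mult nonneg)
    show "u \<bullet> (L (f * f) *v u) = 0"
      if "u \<bullet> (L (monom 1 1 * f * (monom 1 1 * f)) *v u) = 0" for f u
      using that T(4) by (simp add: L_mult) (simp add: op)
  qed blast
  show thesis
  proof
    fix k assume k: "k \<le> 2 * N"
    \<comment> \<open>\<open>T\<close> is the shift only on vectors with vanishing block
      \<open>N\<close>, so its powers at the first block are known up to \<open>N\<close>; hence
      \<open>k\<close> is split into two exponents of at most \<open>N\<close>.\<close>
    define m where "m = min k N"
    define l where "l = k - m"
    have ml: "m \<le> N" "l \<le> N" "k = m + l" using k by (auto simp: m_def l_def)
    have power: "(T ^^ i) (e y) = single i y" if "i \<le> N" for i y
      using that
    proof (induction i)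
      case (Suc i)
      then have "single i y N = 0" by (simp add: single_def)
      moreover have "shift (single i y) = single (Suc i) y"
        by (auto simp: fun_eq_iff single_def shift_def split: nat.split)
      ultimately show ?case using Suc T(3) by simp
    qed (simp add: e_def)
    have "s k = L (monom 1 m * monom 1 l)"
      by (rule matrix_eqI_inner) (simp add: L_mult op power ml block_form_single less_Suc_eq_le)
    then show "s k = (\<Sum>x\<in>\<Lambda>. x ^ k *\<^sub>R A x)"
      by (simp add: \<Lambda>(4) poly_monom power_add ml(3))
  qed (use \<Lambda> in auto)
qed

text \<open>Both forms are restrictions of the large one: to vectors with vanishing last block and
  to shifted vectors.\<close>

lemma block_form_nonneg_restrict:
  assumes "\<And>v. 0 \<le> block_form (Suc N) s v v"
  shows "0 \<le> block_form N s v v" "0 \<le> block_form N (\<lambda>k. s (k + 2)) v v"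
proof -
  define w where "w k = (if k < N then v k else 0)" for k
  have "block_form N s v v = block_form N s w w"
    unfolding block_form_def w_def by (intro sum.cong refl) auto
  then show "0 \<le> block_form N s v v"
    using assms[of w] by (simp add: block_form_restrict w_def)
  show "0 \<le> block_form N (\<lambda>k. s (k + 2)) v v"
    using assms[of "shift v"] by (simp only: block_form_shift_both)
qed

text \<open>A null vector is orthogonal to everything; testing it against its own image in row
  \<open>r\<close>, placed in block \<open>r\<close>, gives a squared norm.\<close>

lemma block_form_eq_0_iff_ker:
  fixes s :: "nat \<Rightarrow> real^'p^'p"
  assumes sym: "\<And>r c. r < N \<Longrightarrow> c < N \<Longrightarrow> transpose (s (r + c)) = s (r + c)"
    and nonneg: "\<And>v. 0 \<le> block_form N s v v"
  shows "block_form N s v v = 0 \<longleftrightarrow> (\<forall>r<N. (\<Sum>c<N. s (r + c) *v v c) = 0)"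
proof
  interpret psd_form "block_form N s" using sym nonneg by (rule psd_form_block_form)
  have row: "block_form N s w v = (\<Sum>r<N. w r \<bullet> (\<Sum>c<N. s (r + c) *v v c))" for w
    by (simp add: block_form_def inner_sum_right)
  show "block_form N s v v = 0" if "\<forall>r<N. (\<Sum>c<N. s (r + c) *v v c) = 0"
    using that by (simp add: row)
  assume v: "block_form N s v v = 0"
  show "\<forall>r<N. (\<Sum>c<N. s (r + c) *v v c) = 0"
  proof (intro allI impI)
    fix r assume r: "r < N"
    let ?y = "\<Sum>c<N. s (r + c) *v v c"
    have "0 = block_form N s (single r ?y) v" using null[OF v] by (metis commute)
    also have "\<dots> = (\<Sum>k<N. if k = r then ?y \<bullet> ?y else 0)"
      unfolding row by (intro sum.cong) (auto simp: single_def)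
    also have "\<dots> = ?y \<bullet> ?y" using r by simp
    finally show "?y = 0" by simp
  qed
qed

subsection \<open>Densities of matrix measures\<close>

text \<open>\<open>measure_of\<close> falls back to the zero measure unless the set function is a
  measure, so its values are known only after this check.\<close>

lemma finite_measure_of_nonneg:
  assumes \<nu>: "signed_borel_measure \<nu>" and nonneg: "\<And>A. A \<in> sets borel \<Longrightarrow> 0 \<le> \<nu> A"
  defines "M \<equiv> measure_of UNIV (sets borel) (\<lambda>A. ennreal (\<nu> A))"
  shows "finite_measure M" "sets M = sets borel" "space M = UNIV"
    "A \<in> sets borel \<Longrightarrow> emeasure M A = ennreal (\<nu> A)"
proof -
  have sub: "sets borel \<subseteq> Pow (UNIV :: real set)" by simp
  show sets: "sets M = sets borel"
    unfolding M_def using sets.sigma_sets_eq[of borel] sub by (simp add: sets_measure_of)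
  show space: "space M = UNIV"
    unfolding M_def by (simp add: space_measure_of)
  have em: "emeasure M A = ennreal (\<nu> A)" if A: "A \<in> sets borel" for A
  proof (rule emeasure_measure_of[OF M_def[THEN meta_eq_to_obj_eq] sub])
    show "positive (sets M) (\<lambda>A. ennreal (\<nu> A))"
      using \<nu> by (simp add: positive_def signed_borel_measure_def)
    show "countably_additive (sets M) (\<lambda>A. ennreal (\<nu> A))"
    proof (rule countably_additiveI)
      fix A :: "nat \<Rightarrow> real set" assume "range A \<subseteq> sets M" "disjoint_family A"
      then have "(\<lambda>n. \<nu> (A n)) sums \<nu> (\<Union>n. A n)" "\<And>n. 0 \<le> \<nu> (A n)"
        using \<nu> nonneg by (auto simp: sets signed_borel_measure_def)
      then show "(\<Sum>n. ennreal (\<nu> (A n))) = ennreal (\<nu> (\<Union>n. A n))"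
        by (intro suminf_ennreal_eq) auto
    qed
    show "A \<in> sets M" using A sets by simp
  qed
  then show "A \<in> sets borel \<Longrightarrow> emeasure M A = ennreal (\<nu> A)" .
  show "finite_measure M"
    by (rule finite_measureI) (simp add: space em)
qed

text \<open>The sign of \<open>\<phi>\<close> gives a Hahn decomposition: the supremum is attained
  at the part of \<open>A\<close> where \<open>\<phi>\<close> is nonnegative.\<close>

lemma pos_variation_density:
  fixes \<tau> :: "real measure"
  assumes sets: "sets \<tau> = sets borel" and \<phi>: "integrable \<tau> \<phi>"
    and \<nu>: "\<And>A. A \<in> sets borel \<Longrightarrow> \<nu> A = (LINT x:A|\<tau>. \<phi> x)"
  shows "pos_variation \<nu> = density \<tau> (\<lambda>x. ennreal (max 0 (\<phi> x)))"
proof -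
  let ?M = "density \<tau> (\<lambda>x. ennreal (max 0 (\<phi> x)))"
  have space: "space \<tau> = UNIV" using sets sets_eq_imp_space_eq by force
  have [measurable]: "\<phi> \<in> borel_measurable \<tau>" using \<phi> by (rule borel_measurable_integrable)
  have pos: "integrable \<tau> (\<lambda>x. max 0 (\<phi> x))" using \<phi> by simp
  have ind: "integrable \<tau> (\<lambda>x. indicator A x *\<^sub>R \<psi> x)" if "A \<in> sets borel" "integrable \<tau> \<psi>"
    for A and \<psi> :: "real \<Rightarrow> real"
    using that sets by (intro integrable_mult_indicator) auto
  have "(SUP B\<in>{B \<in> sets borel. B \<subseteq> A}. ennreal (\<nu> B)) = emeasure ?M A" if A: "A \<in> sets borel" for A
  proof -
    have "emeasure ?M A = (\<integral>\<^sup>+x. ennreal (indicator A x *\<^sub>R max 0 (\<phi> x)) \<partial>\<tau>)"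
      using A sets by (subst emeasure_density) (auto intro!: nn_integral_cong split: split_indicator)
    also have "\<dots> = ennreal (LINT x:A|\<tau>. max 0 (\<phi> x))"
      unfolding set_lebesgue_integral_def by (rule nn_integral_eq_integral[OF ind[OF A pos]]) auto
    finally have em: "emeasure ?M A = ennreal (LINT x:A|\<tau>. max 0 (\<phi> x))" .
    show ?thesis
    proof (rule antisym)
      show "(SUP B\<in>{B \<in> sets borel. B \<subseteq> A}. ennreal (\<nu> B)) \<le> emeasure ?M A"
        unfolding em
      proof (rule SUP_least, rule ennreal_leI)
        fix B assume B: "B \<in> {B \<in> sets borel. B \<subseteq> A}"
        then show "\<nu> B \<le> (LINT x:A|\<tau>. max 0 (\<phi> x))"
          using ind[OF _ \<phi>] ind[OF A pos] unfolding \<nu>[of B] set_lebesgue_integral_def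
          by (subst \<nu>) (auto simp: set_lebesgue_integral_def intro!: integral_mono split: split_indicator)
      qed
      let ?B = "A \<inter> {x. 0 \<le> \<phi> x}"
      have "{x \<in> space \<tau>. 0 \<le> \<phi> x} \<in> sets \<tau>" by measurable
      then have B: "?B \<in> sets borel" using A sets space by simp
      have "emeasure ?M A = ennreal (\<nu> ?B)"
        unfolding em \<nu>[OF B] set_lebesgue_integral_def
        by (intro arg_cong[of _ _ ennreal] Bochner_Integration.integral_cong) (auto split: split_indicator)
      also have "\<dots> \<le> (SUP B\<in>{B \<in> sets borel. B \<subseteq> A}. ennreal (\<nu> B))"
        using B by (intro SUP_upper) auto
      finally show "emeasure ?M A \<le> (SUP B\<in>{B \<in> sets borel. B \<subseteq> A}. ennreal (\<nu> B))" .
    qed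
  qed
  then have "pos_variation \<nu> = measure_of UNIV (sets borel) (emeasure ?M)"
    unfolding pos_variation_def using sets.sigma_sets_eq[of borel]
    by (intro measure_of_eq) auto
  also have "\<dots> = ?M"
    using measure_of_of_measure[of ?M] sets space by simp
  finally show ?thesis .
qed

text \<open>The two variations have the positive and the negative part of \<open>\<phi>\<close> as
  densities. The bound on \<open>\<phi>\<close> keeps \<open>f\<close> integrable against each, so
  that the two integrals can be merged.\<close>

lemma signed_integral_density:
  fixes \<tau> :: "real measure"
  assumes sets: "sets \<tau> = sets borel" and \<phi>: "integrable \<tau> \<phi>"
    and \<nu>: "\<And>A. A \<in> sets borel \<Longrightarrow> \<nu> A = (LINT x:A|\<tau>. \<phi> x)"
    and bound: "AE x in \<tau>. \<bar>\<phi> x\<bar> \<le> 1" and f: "integrable \<tau> f"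
  shows "signed_integral \<nu> f = (LINT x|\<tau>. f x * \<phi> x)"
proof -
  have [measurable]: "\<phi> \<in> borel_measurable \<tau>" "f \<in> borel_measurable \<tau>"
    using \<phi> f by auto
  have neg: "neg_variation \<nu> = density \<tau> (\<lambda>x. ennreal (max 0 (- \<phi> x)))"
    unfolding neg_variation_def
    by (rule pos_variation_density) (use sets \<phi> \<nu> in \<open>auto simp: set_lebesgue_integral_def\<close>)
  have pos: "pos_variation \<nu> = density \<tau> (\<lambda>x. ennreal (max 0 (\<phi> x)))"
    by (rule pos_variation_density[OF sets \<phi>]) (rule \<nu>)
  have int: "integrable \<tau> (\<lambda>x. max 0 (c * \<phi> x) *\<^sub>R f x)" if "\<bar>c\<bar> = 1" for c
  proof (rule Bochner_Integration.integrable_bound[OF f])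
    show "AE x in \<tau>. norm (max 0 (c * \<phi> x) *\<^sub>R f x) \<le> norm (f x)"
      using bound
    proof eventually_elim
      case (elim x)
      then have "\<bar>max 0 (c * \<phi> x)\<bar> \<le> 1" using that by (auto simp: abs_if split: if_splits)
      then show ?case by (simp add: abs_mult mult_left_le_one_le)
    qed
  qed measurable
  have "signed_integral \<nu> f =
      (LINT x|\<tau>. max 0 (\<phi> x) *\<^sub>R f x) - (LINT x|\<tau>. max 0 (- \<phi> x) *\<^sub>R f x)"
    unfolding signed_integral_def neg pos
    by (simp add: integral_density)
  also have "\<dots> = (LINT x|\<tau>. max 0 (\<phi> x) *\<^sub>R f x - max 0 (- \<phi> x) *\<^sub>R f x)"
    using int[of 1] int[of "-1"] by (intro Bochner_Integration.integral_diff[symmetric]) auto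
  also have "\<dots> = (LINT x|\<tau>. f x * \<phi> x)"
    by (intro Bochner_Integration.integral_cong) (auto simp: max_def)
  finally show ?thesis .
qed

text \<open>Testing on the sum and the difference of two unit vectors bounds twice the entry by the
  sum of two diagonal entries.\<close>

lemma psd_matrix_entry_le_trace:
  fixes A :: "real^'n^'n"
  assumes "psd_matrix A"
  shows "\<bar>A $ i $ j\<bar> \<le> trace A"
proof -
  have ax: "axis k 1 \<bullet> (A *v axis l 1) = A $ k $ l" for k l
    by (simp add: inner_axis' matrix_vector_mult_basis column_def)
  have diag: "0 \<le> A $ k $ k" for k
    using assms ax[of k k] by (metis psd_matrix_def)
  then have le: "A $ k $ k \<le> trace A" for k
    unfolding trace_def by (intro member_le_sum) auto
  have tr: "A $ j $ i = A $ i $ j"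
  proof -
    have "transpose A $ i $ j = A $ i $ j"
      using assms by (simp only: psd_matrix_def)
    then show ?thesis by (simp add: transpose_def)
  qed
  have "0 \<le> (axis i 1 + axis j 1) \<bullet> (A *v (axis i 1 + axis j 1))"
    "0 \<le> (axis i 1 - axis j 1) \<bullet> (A *v (axis i 1 - axis j 1))"
    using assms by (auto simp: psd_matrix_def)
  then have "2 * \<bar>A $ i $ j\<bar> \<le> A $ i $ i + A $ j $ j"
    by (simp add: matrix_vector_right_distrib matrix_vector_mult_diff_distrib inner_add_left inner_diff_left inner_add_right
        inner_diff_right ax tr)
  then show ?thesis using le[of i] le[of j] by linarith
qed

section \<open>Trace measure and matrix density\<close>

lemma signed_borel_measure_add:
  "signed_borel_measure \<nu> \<Longrightarrow> signed_borel_measure \<nu>' \<Longrightarrow> signed_borel_measure (\<lambda>A. \<nu> A + \<nu>' A)"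
  by (auto simp: signed_borel_measure_def intro: sums_add)

lemma signed_borel_measure_sum:
  "(\<And>i. i \<in> I \<Longrightarrow> signed_borel_measure (\<nu> i)) \<Longrightarrow> signed_borel_measure (\<lambda>A. \<Sum>i\<in>I. \<nu> i A)"
  by (auto simp: signed_borel_measure_def intro!: sums_sum)

lemma trace_measure:
  assumes "positive_matrix_measure \<mu>"
  shows "finite_measure (trace_measure \<mu>)" "sets (trace_measure \<mu>) = sets borel"
    "space (trace_measure \<mu>) = UNIV"
    "A \<in> sets borel \<Longrightarrow> emeasure (trace_measure \<mu>) A = ennreal (trace (\<mu> A))"
    "signed_borel_measure (\<lambda>A. trace (\<mu> A))"
    "A \<in> sets borel \<Longrightarrow> 0 \<le> trace (\<mu> A)"
proof -
  show s: "signed_borel_measure (\<lambda>A. trace (\<mu> A))"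
    unfolding trace_def using assms
    by (intro signed_borel_measure_sum) (auto simp: positive_matrix_measure_def)
  show n: "0 \<le> trace (\<mu> A)" if "A \<in> sets borel" for A
    using assms that psd_matrix_entry_le_trace[of "\<mu> A"]
    by (meson abs_ge_zero order_trans positive_matrix_measure_def)
  show "finite_measure (trace_measure \<mu>)" "sets (trace_measure \<mu>) = sets borel"
    "space (trace_measure \<mu>) = UNIV"
    "A \<in> sets borel \<Longrightarrow> emeasure (trace_measure \<mu>) A = ennreal (trace (\<mu> A))"
    unfolding trace_measure_def using finite_measure_of_nonneg[OF s n] by auto
qed

text \<open>The entry \<open>\<mu> $ i $ j\<close> is dominated by the trace, so adding the trace makes it a finite measure to
  which the Radon-Nikodym theorem applies.  Semidefiniteness of the density holds almost everywhere for
  a countable dense set of vectors, hence for all by continuity.\<close>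

lemma matrix_measure_density:
  fixes \<mu> :: "real set \<Rightarrow> real^'p^'p"
  assumes \<mu>: "positive_matrix_measure \<mu>"
  obtains \<Phi> :: "real \<Rightarrow> real^'p^'p"
  where "\<And>i j. integrable (trace_measure \<mu>) (\<lambda>x. \<Phi> x $ i $ j)"
    and "\<And>i j A. A \<in> sets borel \<Longrightarrow> \<mu> A $ i $ j = (LINT x:A|trace_measure \<mu>. \<Phi> x $ i $ j)"
    and "\<And>i j. AE x in trace_measure \<mu>. \<bar>\<Phi> x $ i $ j\<bar> \<le> 1"
    and "AE x in trace_measure \<mu>. \<forall>u. 0 \<le> u \<bullet> (\<Phi> x *v u)"
proof -
  define \<tau> where "\<tau> = trace_measure \<mu>"
  note \<tau> = trace_measure[OF \<mu>, folded \<tau>_def]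
  interpret \<tau>: finite_measure \<tau> by (rule \<tau>(1))
  have measure_\<tau>: "measure \<tau> A = trace (\<mu> A)" if "A \<in> sets borel" for A
    using \<tau>(4,6)[OF that] by (simp add: measure_def)
  have entry: "\<bar>\<mu> A $ i $ j\<bar> \<le> trace (\<mu> A)" if "A \<in> sets borel" for A i j
    using \<mu> that by (intro psd_matrix_entry_le_trace) (auto simp: positive_matrix_measure_def)
  have set_one: "(LINT x:A|\<tau>. 1) = trace (\<mu> A)" if "A \<in> sets borel" for A
    using that by (simp add: set_lebesgue_integral_def \<tau>(2,3) measure_\<tau>)
  have set_int: "set_integrable \<tau> A f" if "A \<in> sets borel" "integrable \<tau> f" for A and f :: "real \<Rightarrow> real"
    unfolding set_integrable_def using that \<tau>(2) by (intro integrable_mult_indicator) auto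
  have "\<exists>\<phi>. integrable \<tau> \<phi> \<and> (\<forall>A\<in>sets borel. \<mu> A $ i $ j = (LINT x:A|\<tau>. \<phi> x))" for i j
  proof -
    define \<nu> where "\<nu> A = \<mu> A $ i $ j + trace (\<mu> A)" for A
    have s: "signed_borel_measure \<nu>"
      unfolding \<nu>_def using \<mu> \<tau>(5) by (intro signed_borel_measure_add) (auto simp: positive_matrix_measure_def)
    have n: "0 \<le> \<nu> A" if "A \<in> sets borel" for A
      using entry[OF that, of i j] by (simp add: \<nu>_def abs_le_iff)
    define M where "M = measure_of UNIV (sets borel) (\<lambda>A. ennreal (\<nu> A))"
    note M = finite_measure_of_nonneg[OF s n, folded M_def]
    have "absolutely_continuous \<tau> M"
      unfolding absolutely_continuous_def
    proof
      fix A assume "A \<in> null_sets \<tau>"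
      then have A: "A \<in> sets borel" "trace (\<mu> A) = 0"
        using \<tau>(2,4,6) by (auto simp: null_sets_def)
      then have "\<nu> A = 0" using entry[OF A(1), of i j] by (simp add: \<nu>_def)
      then show "A \<in> null_sets M" using M A by (simp add: null_sets_def)
    qed
    moreover have "sets M = sets \<tau>" using M \<tau> by simp
    moreover obtain D where D: "D \<in> borel_measurable \<tau>" "AE x in \<tau>. RN_deriv \<tau> M x = ennreal (D x)"
        "\<And>x. 0 \<le> D x"
      using \<tau>.real_RN_deriv[OF M(1) calculation] by blast
    ultimately have dens: "density \<tau> (RN_deriv \<tau> M) = M"
      by (intro \<tau>.density_RN_deriv)
    have em: "(\<integral>\<^sup>+x. ennreal (D x) * indicator A x \<partial>\<tau>) = ennreal (\<nu> A)" if "A \<in> sets borel" for A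
    proof -
      have "ennreal (\<nu> A) = emeasure (density \<tau> (RN_deriv \<tau> M)) A"
        using M that dens by simp
      also have "\<dots> = (\<integral>\<^sup>+x. RN_deriv \<tau> M x * indicator A x \<partial>\<tau>)"
        using that \<tau>(2) by (intro emeasure_density) auto
      also have "\<dots> = (\<integral>\<^sup>+x. ennreal (D x) * indicator A x \<partial>\<tau>)"
        using D(2) by (intro nn_integral_cong_AE) auto
      finally show ?thesis by simp
    qed
    have D_int: "integrable \<tau> D"
      using em[of UNIV] D by (intro integrableI_nonneg) auto
    have set_D: "(LINT x:A|\<tau>. D x) = \<nu> A" if A: "A \<in> sets borel" for A
    proof -
      have "ennreal (LINT x:A|\<tau>. D x) = (\<integral>\<^sup>+x. ennreal (indicator A x *\<^sub>R D x) \<partial>\<tau>)"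
        unfolding set_lebesgue_integral_def using A \<tau>(2) D D_int
        by (intro nn_integral_eq_integral[symmetric] integrable_mult_indicator) auto
      also have "\<dots> = (\<integral>\<^sup>+x. ennreal (D x) * indicator A x \<partial>\<tau>)"
        by (intro nn_integral_cong) (auto split: split_indicator)
      finally have "ennreal (LINT x:A|\<tau>. D x) = ennreal (\<nu> A)" using em[OF A] by simp
      moreover have "0 \<le> (LINT x:A|\<tau>. D x)"
        unfolding set_lebesgue_integral_def using D(3) by (intro integral_nonneg_AE) auto
      ultimately show ?thesis using n[OF A] by simp
    qed
    \<comment> \<open>The trace has density 1 with respect to \<open>\<tau>\<close>, so subtracting
      1 removes the trace added in \<open>\<nu>\<close>.\<close>
    have "\<mu> A $ i $ j = (LINT x:A|\<tau>. D x - 1)" if A: "A \<in> sets borel" for A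
    proof -
      have "(LINT x:A|\<tau>. D x - 1) = (LINT x:A|\<tau>. D x) - (LINT x:A|\<tau>. 1)"
        using A D_int by (intro set_integral_diff set_int) auto
      then show ?thesis using set_D[OF A] set_one[OF A] by (simp add: \<nu>_def)
    qed
    then show ?thesis using D_int by (intro exI[of _ "\<lambda>x. D x - 1"]) auto
  qed
  then obtain \<phi> where \<phi>: "\<And>i j. integrable \<tau> (\<phi> i j)"
      "\<And>i j A. A \<in> sets borel \<Longrightarrow> \<mu> A $ i $ j = (LINT x:A|\<tau>. \<phi> i j x)"
    by metis
  define \<Phi> where "\<Phi> x = (\<chi> i j. \<phi> i j x)" for x
  \<comment> \<open>Used with \<open>c = 1\<close> and \<open>c = -1\<close>; both hold because the
    entries of \<open>\<mu>\<close> are dominated by the trace on every Borel set.\<close>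
  have bound: "AE x in \<tau>. 0 \<le> 1 + c * \<phi> i j x" if c: "\<bar>c\<bar> = 1" for c i j
  proof (rule \<tau>.density_nonneg)
    show "integrable \<tau> (\<lambda>x. 1 + c * \<phi> i j x)" using \<phi>(1) by simp
    fix A assume "A \<in> sets \<tau>"
    then have A: "A \<in> sets borel" using \<tau>(2) by simp
    have "(LINT x:A|\<tau>. 1 + c * \<phi> i j x) = (LINT x:A|\<tau>. 1) + (LINT x:A|\<tau>. c * \<phi> i j x)"
      using A \<phi>(1) by (intro set_integral_add set_int) auto
    also have "\<dots> = trace (\<mu> A) + c * \<mu> A $ i $ j"
      using set_one[OF A] \<phi>(2)[OF A] by simp
    also have "\<dots> \<ge> 0"
      using entry[OF A, of i j] c by (auto simp: abs_if split: if_splits)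
    finally show "0 \<le> (LINT x:A|\<tau>. 1 + c * \<phi> i j x)" .
  qed
  have quad: "AE x in \<tau>. 0 \<le> u \<bullet> (\<Phi> x *v u)" for u
  proof (rule \<tau>.density_nonneg)
    have eq: "u \<bullet> (A *v u) = (\<Sum>i\<in>UNIV. \<Sum>j\<in>UNIV. u $ i * u $ j * A $ i $ j)" for A :: "real^'p^'p"
      by (simp add: inner_vec_def matrix_vector_mult_def sum_distrib_left mult_ac)
    show "integrable \<tau> (\<lambda>x. u \<bullet> (\<Phi> x *v u))"
      unfolding eq using \<phi>(1) by (simp add: \<Phi>_def)
    fix A assume "A \<in> sets \<tau>"
    then have A: "A \<in> sets borel" using \<tau>(2) by simp
    have "(LINT x:A|\<tau>. u \<bullet> (\<Phi> x *v u)) = (\<Sum>i\<in>UNIV. \<Sum>j\<in>UNIV. u $ i * u $ j * (LINT x:A|\<tau>. \<phi> i j x))"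
    proof -
      have "(LINT x:A|\<tau>. u \<bullet> (\<Phi> x *v u)) =
          (LINT x|\<tau>. (\<Sum>i\<in>UNIV. \<Sum>j\<in>UNIV. u $ i * u $ j * (indicator A x *\<^sub>R \<phi> i j x)))"
        unfolding set_lebesgue_integral_def eq
        by (intro Bochner_Integration.integral_cong) (simp_all add: \<Phi>_def sum_distrib_left mult_ac)
      then show ?thesis
        using set_int[OF A \<phi>(1)] by (simp add: set_integrable_def set_lebesgue_integral_def)
    qed
    also have "\<dots> = u \<bullet> (\<mu> A *v u)"
      by (simp add: eq \<phi>(2)[OF A])
    also have "\<dots> \<ge> 0" using \<mu> A by (auto simp: positive_matrix_measure_def psd_matrix_def)
    finally show "0 \<le> (LINT x:A|\<tau>. u \<bullet> (\<Phi> x *v u))" .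
  qed
  obtain C :: "(real^'p) set" where C: "countable C" "\<And>X. open X \<Longrightarrow> X \<noteq> {} \<Longrightarrow> \<exists>d\<in>C. d \<in> X"
    by (erule countable_dense_setE)
  have "AE x in \<tau>. \<forall>u\<in>C. 0 \<le> u \<bullet> (\<Phi> x *v u)"
    using C(1) quad by (simp add: AE_ball_countable)
  then have psd: "AE x in \<tau>. \<forall>u. 0 \<le> u \<bullet> (\<Phi> x *v u)"
  proof eventually_elim
    case (elim x)
    have "open {u. u \<bullet> (\<Phi> x *v u) < 0}"
      by (intro open_Collect_less continuous_intros)
    then have "{u. u \<bullet> (\<Phi> x *v u) < 0} = {}"
      using C(2) elim by (metis (mono_tags, lifting) mem_Collect_eq not_less)
    then show ?case by (simp add: set_eq_iff not_less)
  qed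
  show thesis
  proof
    fix i j
    show "integrable (trace_measure \<mu>) (\<lambda>x. \<Phi> x $ i $ j)"
      using \<phi>(1) by (simp add: \<Phi>_def \<tau>_def)
    show "\<mu> A $ i $ j = (LINT x:A|trace_measure \<mu>. \<Phi> x $ i $ j)" if "A \<in> sets borel" for A
      using \<phi>(2)[OF that] by (simp add: \<Phi>_def \<tau>_def)
    have "AE x in \<tau>. \<bar>\<phi> i j x\<bar> \<le> 1"
      using bound[of 1 i j] bound[of "-1" i j] by (auto simp: abs_le_iff)
    then show "AE x in trace_measure \<mu>. \<bar>\<Phi> x $ i $ j\<bar> \<le> 1"
      unfolding \<tau>_def by (simp add: \<Phi>_def)
    show "AE x in trace_measure \<mu>. \<forall>u. 0 \<le> u \<bullet> (\<Phi> x *v u)"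
      using psd unfolding \<tau>_def .
  qed
qed

section \<open>Hankel forms of a representing measure\<close>

lemma borel_measurable_power_int [measurable]: "(\<lambda>x::real. x powi i) \<in> borel_measurable borel"
  unfolding power_int_def by measurable

lemma positive_measure_hankel:
  fixes \<mu> :: "real set \<Rightarrow> real^'p^'p"
  assumes \<mu>: "positive_matrix_measure \<mu>" and mom: "has_moments n1 n2 S \<mu>" and n1: "n1 \<ge> 1"
  defines "s \<equiv> \<lambda>k. S (int k - 2 * int n1)" and "N \<equiv> n1 + n2"
  shows "0 \<le> block_form (Suc N) s v v"
    and "block_form N s v v = 0 \<longleftrightarrow> block_form N (\<lambda>k. s (k + 2)) v v = 0"
proof -
  define \<tau> where "\<tau> = trace_measure \<mu>"
  note \<tau> = trace_measure[OF \<mu>, folded \<tau>_def]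
  obtain \<Phi> where \<Phi>: "\<And>i j. integrable \<tau> (\<lambda>x. \<Phi> x $ i $ j)"
    "\<And>i j A. A \<in> sets borel \<Longrightarrow> \<mu> A $ i $ j = (LINT x:A|\<tau>. \<Phi> x $ i $ j)"
    "\<And>i j. AE x in \<tau>. \<bar>\<Phi> x $ i $ j\<bar> \<le> 1"
    "AE x in \<tau>. \<forall>u. 0 \<le> u \<bullet> (\<Phi> x *v u)"
    using matrix_measure_density[OF \<mu>] unfolding \<tau>_def by blast
  have "\<mu> {0} = 0"
    using mom n1 by (auto simp: has_moments_def dest!: bspec[of _ _ "- 1"])
  then have "emeasure \<tau> {0} = 0"
    by (simp add: \<tau>(4) trace_def)
  then have nz: "AE x in \<tau>. x \<noteq> 0"
    using \<tau>(2,3) by (intro AE_I[of _ _ "{0}"]) auto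
  have moment: "has_bochner_integral \<tau> (\<lambda>x. x powi k * (u \<bullet> (\<Phi> x *v w))) (u \<bullet> (S k *v w))"
    if k: "- 2 * int n1 \<le> k" "k \<le> 2 * int n2" for k u w
  proof -
    have f: "integrable \<tau> (\<lambda>x. x powi k)" and S: "S k = matrix_integral \<mu> (\<lambda>x. x powi k)"
      using mom k by (auto simp: has_moments_def matrix_integrable_def \<tau>_def)
    have "has_bochner_integral \<tau> (\<lambda>x. x powi k * \<Phi> x $ i $ j) (S k $ i $ j)" for i j
    proof -
      have "integrable \<tau> (\<lambda>x. x powi k * \<Phi> x $ i $ j)"
      proof (rule Bochner_Integration.integrable_bound[OF f])
        show "(\<lambda>x. x powi k * \<Phi> x $ i $ j) \<in> borel_measurable \<tau>"
          using \<Phi>(1) f by (intro borel_measurable_times) auto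
        show "AE x in \<tau>. norm (x powi k * \<Phi> x $ i $ j) \<le> norm (x powi k)"
          using \<Phi>(3)[of i j] by eventually_elim (simp add: abs_mult mult_left_le)
      qed
      moreover have "S k $ i $ j = (LINT x|\<tau>. x powi k * \<Phi> x $ i $ j)"
        unfolding S matrix_integral_def vec_lambda_beta
        by (rule signed_integral_density[OF \<tau>(2) \<Phi>(1) _ \<Phi>(3) f]) (rule \<Phi>(2))
      ultimately show ?thesis by (simp add: has_bochner_integral_iff)
    qed
    then have "has_bochner_integral \<tau> (\<lambda>x. \<Sum>i\<in>UNIV. \<Sum>j\<in>UNIV. u $ i * (w $ j * (x powi k * \<Phi> x $ i $ j)))
        (\<Sum>i\<in>UNIV. \<Sum>j\<in>UNIV. u $ i * (w $ j * S k $ i $ j))"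
      by (intro has_bochner_integral_sum has_bochner_integral_mult_right)
    then show ?thesis
      by (simp add: inner_matrix_vector sum_distrib_left mult_ac)
  qed
  \<comment> \<open>The vector polynomial with coefficients \<open>v\<close>, times the power
    \<open>a - n1\<close> of the variable. Passing from \<open>a = 0\<close> to \<open>a = 1\<close>
    multiplies it by \<open>x\<close>.\<close>
  define q where "q a K x = (\<Sum>r<K. x powi (int r + a - int n1) *\<^sub>R v r)" for a K x
  \<comment> \<open>\<open>K + a \<le> Suc N\<close> keeps the highest index
    \<open>2 * (K - 1) + 2 * a\<close> of \<open>s\<close> within \<open>2 * N\<close>.\<close>
  have form: "has_bochner_integral \<tau> (\<lambda>x. q (int a) K x \<bullet> (\<Phi> x *v q (int a) K x)) (block_form K (\<lambda>k. s (k + 2 * a)) v v)"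
    if K: "K + a \<le> Suc N" for a K
  proof -
    let ?g = "\<lambda>x. \<Sum>r<K. \<Sum>c<K. x powi (int (r + c + 2 * a) - 2 * int n1) * (v r \<bullet> (\<Phi> x *v v c))"
    have g: "has_bochner_integral \<tau> ?g (block_form K (\<lambda>k. s (k + 2 * a)) v v)"
      unfolding block_form_def s_def
      by (intro has_bochner_integral_sum moment) (use K in \<open>auto simp: N_def\<close>)
    have [measurable]: "(\<lambda>x. \<Phi> x $ i $ j) \<in> borel_measurable \<tau>" for i j
      using \<Phi>(1) by auto
    have [measurable]: "(\<lambda>x. x powi k) \<in> borel_measurable \<tau>" for k
      using borel_measurable_power_int \<tau>(2) by (simp cong: measurable_cong_sets)
    \<comment> \<open>Splitting the exponent can fail at 0, where negative powers are 0 by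
      convention; hence the equality almost everywhere.\<close>
    have "AE x in \<tau>. ?g x = q (int a) K x \<bullet> (\<Phi> x *v q (int a) K x)"
      using nz
    proof eventually_elim
      case (elim x)
      have "x powi (int (r + c + 2 * a) - 2 * int n1) = x powi (int r + int a - int n1) * x powi (int c + int a - int n1)" for r c
        using elim by (subst power_int_add[symmetric]) (auto simp: algebra_simps)
      then show ?case
        unfolding q_def linear_sum[OF matrix_vector_mul_linear]
        by (subst sum.swap) (simp add: inner_sum_left inner_sum_right matrix_vector_mult_scaleR sum_distrib_left mult_ac)
    qed
    moreover have "(\<lambda>x. q (int a) K x \<bullet> (\<Phi> x *v q (int a) K x)) \<in> borel_measurable \<tau>"
      unfolding inner_matrix_vector q_def by simp
    ultimately show ?thesis
      using g by (subst (asm) has_bochner_integral_cong_AE[OF borel_measurable_has_bochner_integral[OF g]])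
  qed
  have nonneg: "AE x in \<tau>. 0 \<le> q a K x \<bullet> (\<Phi> x *v q a K x)" for a K
    using \<Phi>(4) by eventually_elim simp
  show "0 \<le> block_form (Suc N) s v v"
    using form[of "Suc N" 0] integral_nonneg_AE[OF nonneg[of 0 "Suc N"]]
    by (simp add: has_bochner_integral_iff)
  have eq0: "block_form K (\<lambda>k. s (k + 2 * a)) v v = 0 \<longleftrightarrow> (AE x in \<tau>. q (int a) K x \<bullet> (\<Phi> x *v q (int a) K x) = 0)"
    if "K + a \<le> Suc N" for a K
    using form[OF that] integral_nonneg_eq_0_iff_AE[OF _ nonneg, of "int a" K] by (simp add: has_bochner_integral_iff)
  have "(AE x in \<tau>. q 0 N x \<bullet> (\<Phi> x *v q 0 N x) = 0) \<longleftrightarrow> (AE x in \<tau>. q 1 N x \<bullet> (\<Phi> x *v q 1 N x) = 0)"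
  proof (rule eventually_subst)
    show "AE x in \<tau>. (q 0 N x \<bullet> (\<Phi> x *v q 0 N x) = 0) = (q 1 N x \<bullet> (\<Phi> x *v q 1 N x) = 0)"
      using nz
    proof eventually_elim
      case (elim x)
      have "x powi (int r + 1 - int n1) = x * x powi (int r + 0 - int n1)" for r
        using elim power_int_add[of x 1 "int r - int n1"] by (simp add: algebra_simps)
      then have "q 1 N x = x *\<^sub>R q 0 N x"
        unfolding q_def scaleR_sum_right by (intro sum.cong) simp_all
      then show ?case using elim by (simp add: matrix_vector_mult_scaleR)
    qed
  qed
  then show "block_form N s v v = 0 \<longleftrightarrow> block_form N (\<lambda>k. s (k + 2)) v v = 0"
    using eq0[of N 0] eq0[of N 1] by simp
qed

subsection \<open>Finitely atomic measures\<close>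

lemma psd_matrix_sum:
  "(\<And>i. i \<in> I \<Longrightarrow> psd_matrix (A i)) \<Longrightarrow> psd_matrix (\<Sum>i\<in>I. A i)"
proof (induction I rule: infinite_finite_induct)
  case (insert i I)
  then show ?case
    by (auto simp: psd_matrix_def matrix_vector_mult_add_rdistrib inner_add_right transpose_def vec_eq_iff)
qed (auto simp: psd_matrix_def transpose_def vec_eq_iff)

lemma psd_matrix_scaleR: "psd_matrix A \<Longrightarrow> 0 \<le> c \<Longrightarrow> psd_matrix (c *\<^sub>R A)"
  by (auto simp: psd_matrix_def transpose_def vec_eq_iff simp flip: scaleR_matrix_vector_assoc)

lemma finitely_atomic_positive:
  fixes \<mu> :: "real set \<Rightarrow> real^'p^'p"
  assumes "finitely_atomic \<mu>"
  shows "positive_matrix_measure \<mu>"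
proof -
  obtain l x A where A: "\<And>j. j < (l::nat) \<Longrightarrow> psd_matrix (A j)"
    and \<mu>: "\<And>\<Delta>. \<Delta> \<in> sets borel \<Longrightarrow> \<mu> \<Delta> = (\<Sum>j<l. indicator \<Delta> (x j) *\<^sub>R A j)"
    using assms unfolding finitely_atomic_def by blast
  have "signed_borel_measure (\<lambda>\<Delta>. \<mu> \<Delta> $ i $ k)" for i k
    unfolding signed_borel_measure_def
  proof (intro conjI allI impI)
    show "\<mu> {} $ i $ k = 0" by (simp add: \<mu>)
    fix B :: "nat \<Rightarrow> real set" assume B: "range B \<subseteq> sets borel" "disjoint_family B"
    have "(\<lambda>n. \<Sum>j<l. indicator (B n) (x j) * A j $ i $ k) sums
        (\<Sum>j<l. indicator (\<Union>n. B n) (x j) * A j $ i $ k)"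
      using B(2) by (intro sums_sum sums_mult2 indicator_sums) (auto simp: disjoint_family_on_def)
    moreover have "\<mu> (B n) $ i $ k = (\<Sum>j<l. indicator (B n) (x j) * A j $ i $ k)" for n
      using B(1) by (subst \<mu>) auto
    moreover have "\<mu> (\<Union>n. B n) $ i $ k = (\<Sum>j<l. indicator (\<Union>n. B n) (x j) * A j $ i $ k)"
      using B(1) by (subst \<mu>) auto
    ultimately show "(\<lambda>n. \<mu> (B n) $ i $ k) sums \<mu> (\<Union>n. B n) $ i $ k" by simp
  qed
  moreover have "psd_matrix (\<mu> \<Delta>)" if "\<Delta> \<in> sets borel" for \<Delta>
    unfolding \<mu>[OF that] by (intro psd_matrix_sum psd_matrix_scaleR A) auto
  ultimately show ?thesis by (simp add: positive_matrix_measure_def)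
qed

definition atomic_measure :: "real set \<Rightarrow> (real \<Rightarrow> real^'p^'p) \<Rightarrow> real set \<Rightarrow> real^'p^'p" where
  "atomic_measure \<Lambda> A \<Delta> = (\<Sum>x\<in>\<Lambda>. indicator \<Delta> x *\<^sub>R A x)"

context
  fixes \<Lambda> :: "real set" and A :: "real \<Rightarrow> real^'p^'p"
  assumes fin: "finite \<Lambda>" and psd: "\<And>x. psd_matrix (A x)"
begin

lemma finitely_atomic_atomic_measure: "finitely_atomic (atomic_measure \<Lambda> A)"
proof -
  obtain h where h: "bij_betw h {0..<card \<Lambda>} \<Lambda>"
    using ex_bij_betw_nat_finite[OF fin] by blast
  \<comment> \<open>A zero mass is appended because \<open>finitely_atomic\<close> asks for at least
    one summand and \<open>\<Lambda>\<close> may be empty.\<close>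
  define B where "B j = (if j < card \<Lambda> then A (h j) else 0)" for j
  have "atomic_measure \<Lambda> A \<Delta> = (\<Sum>j<Suc (card \<Lambda>). indicator \<Delta> (h j) *\<^sub>R B j)" for \<Delta>
    unfolding atomic_measure_def B_def
    by (simp add: sum.reindex_bij_betw[OF h, symmetric] lessThan_atLeast0)
  moreover have "psd_matrix (B j)" for j
    using psd psd_matrix_sum[of "{}" A] by (simp add: B_def)
  ultimately show ?thesis
    unfolding finitely_atomic_def by (intro exI[of _ "Suc (card \<Lambda>)"]) auto
qed

text \<open>The matrix integral is defined through variations of the entries, so it is computed with
  the density: almost everywhere \<open>f\<close> is a combination of indicators of the
  atoms.\<close>

lemma atomic_measure_integral:
  assumes f [measurable]: "f \<in> borel_measurable borel"
  shows "matrix_integrable (atomic_measure \<Lambda> A) f"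
    and "matrix_integral (atomic_measure \<Lambda> A) f = (\<Sum>x\<in>\<Lambda>. f x *\<^sub>R A x)"
proof -
  let ?\<mu> = "atomic_measure \<Lambda> A"
  have \<mu>: "positive_matrix_measure ?\<mu>"
    by (rule finitely_atomic_positive[OF finitely_atomic_atomic_measure])
  define \<tau> where "\<tau> = trace_measure ?\<mu>"
  note \<tau> = trace_measure[OF \<mu>, folded \<tau>_def]
  interpret \<tau>: finite_measure \<tau> by (rule \<tau>(1))
  obtain \<Phi> where \<Phi>: "\<And>i j. integrable \<tau> (\<lambda>x. \<Phi> x $ i $ j)"
    "\<And>i j B. B \<in> sets borel \<Longrightarrow> ?\<mu> B $ i $ j = (LINT x:B|\<tau>. \<Phi> x $ i $ j)"
    "\<And>i j. AE x in \<tau>. \<bar>\<Phi> x $ i $ j\<bar> \<le> 1"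
    by (rule matrix_measure_density[OF \<mu>, folded \<tau>_def]) blast
  have mass: "?\<mu> {x} = A x" if "x \<in> \<Lambda>" for x
  proof -
    have "?\<mu> {x} = (\<Sum>y\<in>\<Lambda>. if y = x then A x else 0)"
      unfolding atomic_measure_def by (intro sum.cong) auto
    with that fin show ?thesis by simp
  qed
  have borel: "- \<Lambda> \<in> sets borel" using borel_closed[OF finite_imp_closed[OF fin]] by (rule borel_comp)
  have "?\<mu> (- \<Lambda>) = 0" by (simp add: atomic_measure_def)
  then have "emeasure \<tau> (- \<Lambda>) = 0" using \<tau>(4)[OF borel] by (simp add: trace_def)
  then have AE_\<Lambda>: "AE x in \<tau>. x \<in> \<Lambda>"
    using borel \<tau>(2,3) by (intro AE_I[of _ _ "- \<Lambda>"]) auto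
  let ?f = "\<lambda>x. \<Sum>y\<in>\<Lambda>. f y * indicator {y} x"
  have ff: "AE x in \<tau>. ?f x = f x"
    using AE_\<Lambda>
  proof eventually_elim
    case (elim x)
    have "?f x = (\<Sum>y\<in>\<Lambda>. if y = x then f x else 0)"
      by (intro sum.cong) (auto simp: indicator_def)
    with elim fin show ?case by simp
  qed
  have meas: "f \<in> borel_measurable \<tau>" "?f \<in> borel_measurable \<tau>"
    using \<tau>(2) f by (auto cong: measurable_cong_sets)
  have ind: "integrable \<tau> (\<lambda>x. indicator {y} x * g x)" if "integrable \<tau> g" for y and g :: "real \<Rightarrow> real"
    using integrable_mult_indicator[of "{y}" \<tau> g] that \<tau>(2) by simp
  have "integrable \<tau> ?f"
    using ind[of "\<lambda>_. 1"] by (intro Bochner_Integration.integrable_sum) simp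
  then have f_int: "integrable \<tau> f"
    using integrable_cong_AE[OF meas(2,1) ff] by simp
  then show "matrix_integrable ?\<mu> f" by (simp add: matrix_integrable_def \<tau>_def)
  have "matrix_integral ?\<mu> f $ i $ j = (\<Sum>x\<in>\<Lambda>. f x *\<^sub>R A x) $ i $ j" for i j
  proof -
    have "matrix_integral ?\<mu> f $ i $ j = (LINT x|\<tau>. f x * \<Phi> x $ i $ j)"
      unfolding matrix_integral_def vec_lambda_beta
      by (rule signed_integral_density[OF \<tau>(2) \<Phi>(1) _ \<Phi>(3) f_int]) (rule \<Phi>(2))
    also have "\<dots> = (LINT x|\<tau>. (\<Sum>y\<in>\<Lambda>. f y * (indicator {y} x * \<Phi> x $ i $ j)))"
    proof (rule integral_cong_AE)
      show "AE x in \<tau>. f x * \<Phi> x $ i $ j = (\<Sum>y\<in>\<Lambda>. f y * (indicator {y} x * \<Phi> x $ i $ j))"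
        using ff by eventually_elim (simp add: sum_distrib_right[symmetric] mult.assoc[symmetric])
      show "(\<lambda>x. \<Sum>y\<in>\<Lambda>. f y * (indicator {y} x * \<Phi> x $ i $ j)) \<in> borel_measurable \<tau>"
        using ind[OF \<Phi>(1)] by (intro borel_measurable_sum borel_measurable_times borel_measurable_integrable) auto
      show "(\<lambda>x. f x * \<Phi> x $ i $ j) \<in> borel_measurable \<tau>"
        using meas \<Phi>(1) by (intro borel_measurable_times) auto
    qed
    also have "\<dots> = (\<Sum>y\<in>\<Lambda>. f y * (LINT x|\<tau>. indicator {y} x * \<Phi> x $ i $ j))"
      using ind[OF \<Phi>(1)] by (simp add: Bochner_Integration.integral_sum)
    also have "\<dots> = (\<Sum>y\<in>\<Lambda>. f y * A y $ i $ j)"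
    proof (intro sum.cong refl)
      fix y assume "y \<in> \<Lambda>"
      then have "(LINT x|\<tau>. indicator {y} x * \<Phi> x $ i $ j) = A y $ i $ j"
        using \<Phi>(2)[of "{y}" i j] mass[of y] by (simp add: set_lebesgue_integral_def)
      then show "f y * (LINT x|\<tau>. indicator {y} x * \<Phi> x $ i $ j) = f y * A y $ i $ j" by simp
    qed
    finally show ?thesis by simp
  qed
  then show "matrix_integral ?\<mu> f = (\<Sum>x\<in>\<Lambda>. f x *\<^sub>R A x)"
    by (simp add: vec_eq_iff)
qed

lemma has_moments_atomic_measure:
  assumes "0 \<notin> \<Lambda>"
    and "\<And>i. - 2 * int n1 \<le> i \<Longrightarrow> i \<le> 2 * int n2 \<Longrightarrow> S i = (\<Sum>x\<in>\<Lambda>. x powi i *\<^sub>R A x)"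
  shows "has_moments n1 n2 S (atomic_measure \<Lambda> A)"
  unfolding has_moments_def
proof (intro ballI conjI impI)
  show "atomic_measure \<Lambda> A {0} = 0"
    using assms(1) by (auto simp: atomic_measure_def indicator_def intro!: sum.neutral)
qed (use assms(2) in \<open>auto simp: atomic_measure_integral\<close>)

end

subsection \<open>Equivalence of the solvability conditions\<close>

lemma hankel_imp_atomic:
  fixes S :: "int \<Rightarrow> real^'p^'p" and n1 n2 :: nat
  defines "s \<equiv> \<lambda>k. S (int k - 2 * int n1)" and "N \<equiv> n1 + n2"
  assumes sym: "\<forall>i\<in>{- 2 * int n1 .. 2 * int n2}. transpose (S i) = S i"
    and psd: "\<And>v. 0 \<le> block_form (Suc N) s v v"
    and null: "\<And>v. block_form N s v v = 0 \<longleftrightarrow> block_form N (\<lambda>k. s (k + 2)) v v = 0"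
  shows "\<exists>\<mu>. finitely_atomic \<mu> \<and> has_moments n1 n2 S \<mu>"
proof -
  have "transpose (s k) = s k" if "k \<le> 2 * N" for k
    using sym that by (auto simp: s_def N_def)
  then obtain \<Lambda> A where \<Lambda>: "finite \<Lambda>" "0 \<notin> \<Lambda>" "\<And>x. psd_matrix (A x)"
    "\<And>k. k \<le> 2 * N \<Longrightarrow> s k = (\<Sum>x\<in>\<Lambda>. x ^ k *\<^sub>R A x)"
    using hankel_atomic_representation[OF _ psd null] by blast
  \<comment> \<open>The masses absorb the shift of the moments by \<open>2 * n1\<close>; the even
    power keeps them semidefinite.\<close>
  define B where "B x = x ^ (2 * n1) *\<^sub>R A x" for x
  have B: "psd_matrix (B x)" for x
    unfolding B_def by (rule psd_matrix_scaleR[OF \<Lambda>(3)]) (simp add: power_mult)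
  have "S i = (\<Sum>x\<in>\<Lambda>. x powi i *\<^sub>R B x)" if i: "- 2 * int n1 \<le> i" "i \<le> 2 * int n2" for i
  proof -
    define k where "k = nat (i + 2 * int n1)"
    have k: "int k = i + 2 * int n1" "k \<le> 2 * N" using i by (auto simp: k_def N_def)
    have "S i = (\<Sum>x\<in>\<Lambda>. x ^ k *\<^sub>R A x)"
      using \<Lambda>(4)[OF k(2)] by (simp add: s_def k(1))
    also have "\<dots> = (\<Sum>x\<in>\<Lambda>. x powi i *\<^sub>R B x)"
    proof (intro sum.cong refl)
      fix x assume "x \<in> \<Lambda>"
      then have "x \<noteq> 0" using \<Lambda>(2) by auto
      then have "x ^ k = x powi i * x ^ (2 * n1)"
        using power_int_add[of x i "int (2 * n1)"] by (simp only: power_int_of_nat[symmetric] k(1)) simp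
      then show "x ^ k *\<^sub>R A x = x powi i *\<^sub>R B x" by (simp add: B_def)
    qed
    finally show ?thesis .
  qed
  then show ?thesis
    by (intro exI[of _ "atomic_measure \<Lambda> B"] conjI finitely_atomic_atomic_measure
        has_moments_atomic_measure \<Lambda>(1,2) B)
qed

lemma sum_int_interval_shift:
  "(\<Sum>i\<in>{- int n1 .. int n2 - 1}. F i) = (\<Sum>r<n1 + n2. F (int r - int n1))"
proof (rule sum.reindex_bij_witness[of _ "\<lambda>r. int r - int n1" "\<lambda>i. nat (i + int n1)"])
  fix i assume "i \<in> {- int n1 .. int n2 - 1}"
  then show "int (nat (i + int n1)) - int n1 = i" "nat (i + int n1) \<in> {..<n1 + n2}"
    "F (int (nat (i + int n1)) - int n1) = F i" by auto
next
  fix r assume "r \<in> {..<n1 + n2}"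
  then show "nat (int r - int n1 + int n1) = r" "int r - int n1 \<in> {- int n1 .. int n2 - 1}" by auto
qed

theorem corollary1p4:
  fixes n1 n2 :: nat and S :: "int \<Rightarrow> real^'p^'p"
  assumes "n1 \<ge> 1" and "n2 \<ge> 1"
    and "\<forall>i\<in>{- 2 * int n1 .. 2 * int n2}. transpose (S i) = S i"
  shows
    "((\<exists>\<mu>. positive_matrix_measure \<mu> \<and> has_moments n1 n2 S \<mu>)
        \<longleftrightarrow> (\<exists>\<mu>. positive_matrix_measure \<mu> \<and> finitely_atomic \<mu> \<and> has_moments n1 n2 S \<mu>)) \<and>
     ((\<exists>\<mu>. positive_matrix_measure \<mu> \<and> has_moments n1 n2 S \<mu>)
        \<longleftrightarrow> (\<exists>\<mu>. minimal_representing_measure n1 n2 S \<mu> \<and> has_moments n1 n2 S \<mu>)) \<and>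
     ((\<exists>\<mu>. positive_matrix_measure \<mu> \<and> has_moments n1 n2 S \<mu>)
        \<longleftrightarrow> block_psd (n1 + n2 + 1) (moment_block S (- int n1)) \<and>
            block_ker (n1 + n2) (moment_block S (- int n1)) =
            block_ker (n1 + n2) (moment_block S (- int n1 + 1))) \<and>
     ((\<exists>\<mu>. positive_matrix_measure \<mu> \<and> has_moments n1 n2 S \<mu>)
        \<longleftrightarrow> block_psd (n1 + n2 + 1) (moment_block S (- int n1)) \<and>
            (\<forall>v :: nat \<Rightarrow> real^'p.
               (\<Sum>i\<in>{- int n1 .. int n2 - 1}. \<Sum>j\<in>{- int n1 .. int n2 - 1}.
                  v (nat (j + int n1)) \<bullet> (S (i + j) *v v (nat (i + int n1)))) = 0
               \<longleftrightarrow>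
               (\<Sum>i\<in>{- int n1 .. int n2 - 1}. \<Sum>j\<in>{- int n1 .. int n2 - 1}.
                  v (nat (j + int n1)) \<bullet> (S (i + j + 2) *v v (nat (i + int n1)))) = 0))"
proof -
  define s where "s k = S (int k - 2 * int n1)" for k
  define N where "N = n1 + n2"
  have sym: "transpose (s k) = s k" if "k \<le> 2 * N" for k
    using assms(3) that by (auto simp: s_def N_def)
  have block: "moment_block S (- int n1) = (\<lambda>r c. s (r + c))"
    "moment_block S (- int n1 + 1) = (\<lambda>r c. s (r + c + 2))"
    by (auto simp: fun_eq_iff moment_block_def s_def algebra_simps)
  define Psd where "Psd \<longleftrightarrow> (\<forall>v. 0 \<le> block_form (Suc N) s v v)"
  define Null where "Null \<longleftrightarrow> (\<forall>v. block_form N s v v = 0 \<longleftrightarrow> block_form N (\<lambda>k. s (k + 2)) v v = 0)"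
  have psd: "block_psd (n1 + n2 + 1) (moment_block S (- int n1)) \<longleftrightarrow> Psd"
    unfolding block_psd_def block Psd_def block_form_def using sym by (simp add: N_def add.commute)
  have ker: "block_ker (n1 + n2) (moment_block S (- int n1)) = block_ker (n1 + n2) (moment_block S (- int n1 + 1))
      \<longleftrightarrow> Null" if Psd
  proof -
    have nonneg: "\<And>v. 0 \<le> block_form (Suc N) s v v" using that by (simp add: Psd_def)
    have eq: "block_form N s v v = 0 \<longleftrightarrow> (\<forall>r<N. (\<Sum>c<N. s (r + c) *v v c) = 0)"
      "block_form N (\<lambda>k. s (k + 2)) v v = 0 \<longleftrightarrow> (\<forall>r<N. (\<Sum>c<N. s (r + c + 2) *v v c) = 0)" for v
      using block_form_eq_0_iff_ker[of N s v] block_form_eq_0_iff_ker[of N "\<lambda>k. s (k + 2)" v]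
        block_form_nonneg_restrict[of N s, OF nonneg] sym by simp_all
    have "block_ker N (\<lambda>r c. s (r + c)) = block_ker N (\<lambda>r c. s (r + c + 2)) \<longleftrightarrow> Null"
    proof
      assume ker: "block_ker N (\<lambda>r c. s (r + c)) = block_ker N (\<lambda>r c. s (r + c + 2))"
      have "block_form N s v v = 0 \<longleftrightarrow> block_form N (\<lambda>k. s (k + 2)) v v = 0" for v
      proof -
        \<comment> \<open>Elements of \<open>block_ker\<close> vanish from block \<open>N\<close>
          on, while the forms see only the blocks below \<open>N\<close>; so \<open>v\<close> is cut
          off first.\<close>
        define w where "w k = (if k < N then v k else 0)" for k
        have vw: "block_form N t v v = block_form N t w w" for t
          unfolding block_form_def w_def by (intro sum.cong refl) auto
        have "w \<in> block_ker N (\<lambda>r c. s (r + c)) \<longleftrightarrow> w \<in> block_ker N (\<lambda>r c. s (r + c + 2))"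
          using ker by simp
        moreover have "\<forall>k\<ge>N. w k = 0" by (simp add: w_def)
        ultimately show ?thesis
          unfolding vw eq by (simp only: block_ker_def mem_Collect_eq) simp
      qed
      then show Null by (simp add: Null_def)
    next
      assume Null
      then show "block_ker N (\<lambda>r c. s (r + c)) = block_ker N (\<lambda>r c. s (r + c + 2))"
        unfolding block_ker_def Null_def eq by blast
    qed
    then show ?thesis by (simp only: block N_def)
  qed
  \<comment> \<open>The left vector carries the inner index here and the outer one in
    \<open>block_form\<close>, hence the exchange of sums.\<close>
  have sums: "(\<Sum>i\<in>{- int n1 .. int n2 - 1}. \<Sum>j\<in>{- int n1 .. int n2 - 1}.
      v (nat (j + int n1)) \<bullet> (S (i + j + int a) *v v (nat (i + int n1)))) = block_form N (\<lambda>k. s (k + a)) v v" for v a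
  proof -
    have idx: "(int r - int n1) + (int c - int n1) + int a = int (c + r + a) - 2 * int n1" for r c by simp
    show ?thesis
      unfolding sum_int_interval_shift block_form_def N_def s_def idx by (subst sum.swap) simp
  qed
  have form: "(\<forall>v :: nat \<Rightarrow> real^'p.
      (\<Sum>i\<in>{- int n1 .. int n2 - 1}. \<Sum>j\<in>{- int n1 .. int n2 - 1}.
        v (nat (j + int n1)) \<bullet> (S (i + j) *v v (nat (i + int n1)))) = 0 \<longleftrightarrow>
      (\<Sum>i\<in>{- int n1 .. int n2 - 1}. \<Sum>j\<in>{- int n1 .. int n2 - 1}.
        v (nat (j + int n1)) \<bullet> (S (i + j + 2) *v v (nat (i + int n1)))) = 0) \<longleftrightarrow> Null"
    unfolding Null_def using sums[of _ 0] sums[of _ 2] by simp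
  have measure_imp: "Psd \<and> Null" if "positive_matrix_measure \<mu>" "has_moments n1 n2 S \<mu>" for \<mu>
    using positive_measure_hankel[OF that assms(1), folded s_def N_def] by (simp add: Psd_def Null_def)
  have imp_atomic: "\<exists>\<mu>. finitely_atomic \<mu> \<and> has_moments n1 n2 S \<mu>" if "Psd \<and> Null"
    using hankel_imp_atomic[OF assms(3), folded s_def N_def] that by (simp add: Psd_def Null_def)
  \<comment> \<open>Rank sums are natural numbers, so a least one is attained.\<close>
  have minimal: "\<exists>\<mu>. minimal_representing_measure n1 n2 S \<mu>"
    if "finitely_atomic \<mu>" "has_moments n1 n2 S \<mu>" for \<mu>
    using ex_has_least_nat[of "\<lambda>\<nu>. finitely_atomic \<nu> \<and> has_moments n1 n2 S \<nu>" \<mu> mass_rank_sum] that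
    unfolding minimal_representing_measure_def by blast
  show ?thesis
    unfolding psd form
    using ker measure_imp imp_atomic minimal finitely_atomic_positive
    by (smt (verit) minimal_representing_measure_def)
qed

end
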